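(* Let $(W,\omega)$ be a real symplectic vector space of dimension $2n$ and let $\Gamma\colon I\to\mathscr{L}(W)$ be a (regular) Jacobi curve defined on an open interval $I$, parametrized by a projective parameter, and such that $R_\Gamma(t)=0$ for all $t\in I$. Then the image of $\Gamma$ is contained in a regular cycle.
   Context: $(u|v):=\omega(u,v)$. $\mathscr{L}(W)$ is the Lagrangian Grassmannian; $\Lambda^{\pitchfork}$ is the open set of Lagrangian subspaces transverse to $\Lambda$. Affine structure: for $\Gamma_0\in\Delta^{\pitchfork}$, each $\Gamma\in\Delta^{\pitchfork}$ is the graph of a unique linear map $\Gamma_0\to\Delta$, and this identifies $\Delta^{\pitchfork}$ with the vector space of linear maps $A\colon\Gamma_0\to\Delta$ with $(Au|v)+(u|Av)=0$; the affine structure so defined on $\Delta^{\pitchfork}$ is independent of the origin $\Gamma_0$. A (regular) Jacobi curve is a smooth curve $\Gamma(t)$ in $\mathscr{L}(W)$ such that for every $t_0$ the quadratic form $\dot\Gamma(t_0)(v_0)=\omega(v_0,v'(t_0))$ on $\Gamma(t_0)$ (with $v(t)\in\Gamma(t)$ any smooth curve, $v(t_0)=v_0$) is non-degenerate. For each $\tau$ there is a unique $\Delta_\tau\in\Gamma(\tau)^{\pitchfork}$ such that $\Gamma$, viewed for $t$ near $\tau$ as a curve $\Gamma_{\Delta_\tau}$ in the affine space $\Delta_\tau^{\pitchfork}$, satisfies $\Gamma''_{\Delta_\tau}(\tau)=0$. With $\Gamma(\tau)$ as origin, $\Gamma'_{\Delta_\tau}(\tau)$ and $\Gamma'''_{\Delta_\tau}(\tau)$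 are linear maps $\Gamma(\tau)\to\Delta_\tau$, the first invertible; the (Ricci) curvature operator is $R_\Gamma(\tau)=(\Gamma'_{\Delta_\tau}(\tau))^{-1}\circ\Gamma'''_{\Delta_\tau}(\tau)$. The parameter is projective if $\mathrm{tr}\,R_\Gamma(t)=0$ for all $t$. An affine line $L$ in $\overline\Lambda^{\pitchfork}$ ($\overline\Lambda\in\mathscr{L}(W)$) is regular if $\Lambda_1\cap\Lambda_2=\{0\}$ for all $\Lambda_1\neq\Lambda_2$ in $L$. A regular cycle is a set $C=L\cup\{\overline\Lambda\}$ with $\overline\Lambda\in\mathscr{L}(W)$ and $L$ a regular affine line in $\overline\Lambda^{\pitchfork}$. *)

theory Defs
  imports "HOL-Analysis.Analysis"
begin

definition symplectic_form :: "('a::real_vector \<Rightarrow> 'a \<Rightarrow> real) \<Rightarrow> bool" where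
  "symplectic_form \<omega> \<longleftrightarrow>
     bilinear \<omega> \<and> (\<forall>u. \<omega> u u = 0) \<and> (\<forall>u. (\<forall>v. \<omega> u v = 0) \<longrightarrow> u = 0)"

definition lagrangian :: "('a::real_vector \<Rightarrow> 'a \<Rightarrow> real) \<Rightarrow> 'a set \<Rightarrow> bool" where
  "lagrangian \<omega> \<Lambda> \<longleftrightarrow> subspace \<Lambda> \<and> \<Lambda> = {u. \<forall>v\<in>\<Lambda>. \<omega> u v = 0}"

definition transversals :: "('a::real_vector \<Rightarrow> 'a \<Rightarrow> real) \<Rightarrow> 'a set \<Rightarrow> 'a set set" where
  "transversals \<omega> \<Lambda> = {\<Gamma>. lagrangian \<omega> \<Gamma> \<and> \<Gamma> \<inter> \<Lambda> = {0}}"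

text \<open>
  When the whole space is the direct sum of \<open>\<Gamma>\<^sub>0\<close> and \<open>\<Delta>\<close>, a linear map from \<open>\<Gamma>\<^sub>0\<close> to \<open>\<Delta>\<close> is
  represented by its extension by zero on \<open>\<Delta>\<close>.  In this way the maps form a linear subspace of a
  normed space, so that curves of such maps can be differentiated.
\<close>

definition chart_maps ::
    "('a::euclidean_space \<Rightarrow> 'a \<Rightarrow> real) \<Rightarrow> 'a set \<Rightarrow> 'a set \<Rightarrow> ('a \<Rightarrow>\<^sub>L 'a) set" where
  "chart_maps \<omega> \<Gamma>\<^sub>0 \<Delta> =
     {A. (\<forall>w\<in>\<Delta>. blinfun_apply A w = 0) \<and> (\<forall>u\<in>\<Gamma>\<^sub>0. blinfun_apply A u \<in> \<Delta>) \<and>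
         (\<forall>u\<in>\<Gamma>\<^sub>0. \<forall>v\<in>\<Gamma>\<^sub>0. \<omega> (blinfun_apply A u) v + \<omega> u (blinfun_apply A v) = 0)}"

definition graph_over :: "'a::euclidean_space set \<Rightarrow> ('a \<Rightarrow>\<^sub>L 'a) \<Rightarrow> 'a set" where
  "graph_over \<Gamma>\<^sub>0 A = {u + blinfun_apply A u | u. u \<in> \<Gamma>\<^sub>0}"

definition chart ::
    "('a::euclidean_space \<Rightarrow> 'a \<Rightarrow> real) \<Rightarrow> 'a set \<Rightarrow> 'a set \<Rightarrow> 'a set \<Rightarrow> ('a \<Rightarrow>\<^sub>L 'a)" where
  "chart \<omega> \<Gamma>\<^sub>0 \<Delta> \<Gamma> = (THE A. A \<in> chart_maps \<omega> \<Gamma>\<^sub>0 \<Delta> \<and> graph_over \<Gamma>\<^sub>0 A = \<Gamma>)"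

definition nth_deriv :: "nat \<Rightarrow> (real \<Rightarrow> 'b::real_normed_vector) \<Rightarrow> real \<Rightarrow> 'b" where
  "nth_deriv k f = ((\<lambda>g t. vector_derivative g (at t)) ^^ k) f"

text \<open>Meaningful for open \<open>S\<close> only.\<close>

definition smooth_on :: "real set \<Rightarrow> (real \<Rightarrow> 'b::real_normed_vector) \<Rightarrow> bool" where
  "smooth_on S f \<longleftrightarrow> (\<forall>k. \<forall>t\<in>S. nth_deriv k f differentiable (at t))"

text \<open>
  Smoothness for the manifold structure on the Lagrangian Grassmannian whose charts are
  the affine spaces \<open>transversals \<omega> \<Delta>\<close>.
\<close>

definition smooth_lagrangian_curve ::
    "('a::euclidean_space \<Rightarrow> 'a \<Rightarrow> real) \<Rightarrow> real set \<Rightarrow> (real \<Rightarrow> 'a set) \<Rightarrow> bool" where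
  "smooth_lagrangian_curve \<omega> I \<Gamma> \<longleftrightarrow>
     (\<forall>t\<in>I. lagrangian \<omega> (\<Gamma> t)) \<and>
     (\<forall>t\<^sub>0\<in>I. \<exists>J \<Delta>. open J \<and> t\<^sub>0 \<in> J \<and> J \<subseteq> I \<and> lagrangian \<omega> \<Delta> \<and>
        (\<forall>t\<in>J. \<Gamma> t \<in> transversals \<omega> \<Delta>) \<and>
        (\<exists>\<Gamma>\<^sub>0\<in>transversals \<omega> \<Delta>. smooth_on J (\<lambda>t. chart \<omega> \<Gamma>\<^sub>0 \<Delta> (\<Gamma> t))))"

definition velocity_form ::
    "('a::euclidean_space \<Rightarrow> 'a \<Rightarrow> real) \<Rightarrow> (real \<Rightarrow> 'a set) \<Rightarrow> real \<Rightarrow> 'a \<Rightarrow> real" where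
  "velocity_form \<omega> \<Gamma> t\<^sub>0 v\<^sub>0 =
     (THE q. \<exists>J v. open J \<and> t\<^sub>0 \<in> J \<and> smooth_on J v \<and> (\<forall>t\<in>J. v t \<in> \<Gamma> t) \<and> v t\<^sub>0 = v\<^sub>0 \<and>
        q = \<omega> v\<^sub>0 (vector_derivative v (at t\<^sub>0)))"

text \<open>Non-degeneracy of a quadratic form is that of its polar bilinear form.\<close>

definition nondegenerate_quadratic_on :: "'a::real_vector set \<Rightarrow> ('a \<Rightarrow> real) \<Rightarrow> bool" where
  "nondegenerate_quadratic_on V q \<longleftrightarrow>
     (\<forall>u\<in>V. (\<forall>v\<in>V. q (u + v) - q u - q v = 0) \<longrightarrow> u = 0)"

definition jacobi_curve ::
    "('a::euclidean_space \<Rightarrow> 'a \<Rightarrow> real) \<Rightarrow> real set \<Rightarrow> (real \<Rightarrow> 'a set) \<Rightarrow> bool" where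
  "jacobi_curve \<omega> I \<Gamma> \<longleftrightarrow>
     smooth_lagrangian_curve \<omega> I \<Gamma> \<and>
     (\<forall>t\<in>I. nondegenerate_quadratic_on (\<Gamma> t) (velocity_form \<omega> \<Gamma> t))"

definition derivative_element ::
    "('a::euclidean_space \<Rightarrow> 'a \<Rightarrow> real) \<Rightarrow> (real \<Rightarrow> 'a set) \<Rightarrow> real \<Rightarrow> 'a set" where
  "derivative_element \<omega> \<Gamma> \<tau> =
     (THE \<Delta>. \<Delta> \<in> transversals \<omega> (\<Gamma> \<tau>) \<and> nth_deriv 2 (\<lambda>t. chart \<omega> (\<Gamma> \<tau>) \<Delta> (\<Gamma> t)) \<tau> = 0)"

text \<open>
  The curvature operator is an endomorphism of \<open>\<Gamma> \<tau>\<close>; its values outside \<open>\<Gamma> \<tau>\<close> are irrelevant.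
\<close>

definition curvature ::
    "('a::euclidean_space \<Rightarrow> 'a \<Rightarrow> real) \<Rightarrow> (real \<Rightarrow> 'a set) \<Rightarrow> real \<Rightarrow> 'a \<Rightarrow> 'a" where
  "curvature \<omega> \<Gamma> \<tau> =
     (let c = (\<lambda>t. chart \<omega> (\<Gamma> \<tau>) (derivative_element \<omega> \<Gamma> \<tau>) (\<Gamma> t))
      in inv_into (\<Gamma> \<tau>) (blinfun_apply (nth_deriv 1 c \<tau>)) \<circ> blinfun_apply (nth_deriv 3 c \<tau>))"

definition trace_on :: "'a::real_vector set \<Rightarrow> ('a \<Rightarrow> 'a) \<Rightarrow> real" where
  "trace_on V f =
     (let B = (SOME B. independent B \<and> span B = V) in \<Sum>b\<in>B. representation B (f b) b)"

definition projective_parameter ::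
    "('a::euclidean_space \<Rightarrow> 'a \<Rightarrow> real) \<Rightarrow> real set \<Rightarrow> (real \<Rightarrow> 'a set) \<Rightarrow> bool" where
  "projective_parameter \<omega> I \<Gamma> \<longleftrightarrow> (\<forall>t\<in>I. trace_on (\<Gamma> t) (curvature \<omega> \<Gamma> t) = 0)"

definition affine_line ::
    "('a::euclidean_space \<Rightarrow> 'a \<Rightarrow> real) \<Rightarrow> 'a set \<Rightarrow> 'a set set \<Rightarrow> bool" where
  "affine_line \<omega> \<Delta> L \<longleftrightarrow>
     (\<exists>\<Gamma>\<^sub>0\<in>transversals \<omega> \<Delta>. \<exists>A\<in>chart_maps \<omega> \<Gamma>\<^sub>0 \<Delta>.
        A \<noteq> 0 \<and> L = range (\<lambda>s. graph_over \<Gamma>\<^sub>0 (s *\<^sub>R A)))"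

definition regular_line :: "'a::real_vector set set \<Rightarrow> bool" where
  "regular_line L \<longleftrightarrow> (\<forall>\<Lambda>\<^sub>1\<in>L. \<forall>\<Lambda>\<^sub>2\<in>L. \<Lambda>\<^sub>1 \<noteq> \<Lambda>\<^sub>2 \<longrightarrow> \<Lambda>\<^sub>1 \<inter> \<Lambda>\<^sub>2 = {0})"

definition regular_cycle ::
    "('a::euclidean_space \<Rightarrow> 'a \<Rightarrow> real) \<Rightarrow> 'a set set \<Rightarrow> bool" where
  "regular_cycle \<omega> C \<longleftrightarrow>
     (\<exists>\<Lambda> L. lagrangian \<omega> \<Lambda> \<and> affine_line \<omega> \<Lambda> L \<and> regular_line L \<and> C = L \<union> {\<Lambda>})"

end

theory Submission
  imports Defs
begin

text \<open>
  In a chart the curve is the graph of a curve \<open>S\<close> of linear maps, and the derivative element and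
  the curvature at a point are read off the Schwarzian of \<open>S\<close>: one has \<open>S'' = - 2 S' k\<close> for a
  unique endomorphism \<open>k\<close>, which determines the derivative element, and the curvature vanishes
  iff \<open>S''' = - 3 S'' k\<close>.  A vanishing Schwarzian forces \<open>S\<close> to be a linear fractional function of
  the parameter, so near each point the curve is an affine line, traversed with an affine parameter,
  in the affine space defined by its derivative element at that point.  Hence the
  derivative element and the velocity are locally constant along the curve, therefore constant on
  the interval, and the whole curve lies on a single affine line.  The velocity is invertible, so
  that line is regular.
\<close>

section \<open>Curves in normed spaces\<close>

text \<open>A chart centred at \<open>\<Gamma> \<tau>\<close> depends on the complement through some
  \<open>b\<close> mapping \<open>D\<close> to \<open>A\<close>; in it the curve is conjugate to
  \<open>(S - S \<tau>) (1 - b (S - S \<tau>))^-1\<close>. The second derivative at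
  \<open>\<tau>\<close> is \<open>S'' + 2 S' b S'\<close>, whence \<open>k = b S'\<close>; the third
  is then \<open>S''' - 6 S' k k\<close>, that is \<open>S''' + 3 S'' k\<close>. The obstacle is
  that \<open>k\<close> is obtained separately at each parameter, with no control on how it varies,
  so it is never differentiated. Instead a linear fractional candidate is built from the single
  value \<open>K = k t0\<close>, its denominator is cleared, and the error is estimated: the second
  and third derivatives of the error are \<open>-2 S' z\<close> and \<open>-3 S'' z\<close> with the
  same \<open>z\<close>, so invertibility of \<open>S'\<close> bounds the third by the second, and
  the error vanishes near \<open>t0\<close>. To pass to the interval, each local line is recorded by
  data that do not depend on the base point, among them its extrapolation to parameter zero.\<close>

lemma has_vector_derivative_iff_slope:
  fixes f :: "real \<Rightarrow> 'b::real_normed_vector"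
  shows "(f has_vector_derivative f') (at x) \<longleftrightarrow> ((\<lambda>y. (f y - f x) /\<^sub>R (y - x)) \<longlongrightarrow> f') (at x)"
proof -
  have "norm ((f y - f x) /\<^sub>R (y - x) - f') = norm (f y - f x - (y - x) *\<^sub>R f') / norm (y - x)"
    if "y \<noteq> x" for y
  proof -
    have "(f y - f x) /\<^sub>R (y - x) - f' = (f y - f x - (y - x) *\<^sub>R f') /\<^sub>R (y - x)"
      using that by (simp add: scaleR_diff_right)
    then show ?thesis by (simp add: divide_inverse mult.commute)
  qed
  then have "((\<lambda>y. norm ((f y - f x) /\<^sub>R (y - x) - f')) \<longlongrightarrow> 0) (at x) \<longleftrightarrow>
     ((\<lambda>y. norm (f y - f x - (y - x) *\<^sub>R f') / norm (y - x)) \<longlongrightarrow> 0) (at x)"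
    by (intro filterlim_cong) (auto simp: eventually_at_filter)
  moreover have "((\<lambda>y. (f y - f x) /\<^sub>R (y - x)) \<longlongrightarrow> f') (at x) \<longleftrightarrow>
     ((\<lambda>y. norm ((f y - f x) /\<^sub>R (y - x) - f')) \<longlongrightarrow> 0) (at x)"
    unfolding tendsto_norm_zero_iff by (rule LIM_zero_iff[symmetric])
  ultimately show ?thesis
    unfolding has_vector_derivative_def has_derivative_iff_norm
    using bounded_linear_scaleR_left by blast
qed

text \<open>Difference quotients stay in the subspace, and closedness passes this to their limit.
  Applied to \<open>chart_maps\<close>, it makes the derivatives of a curve of chart maps chart maps
  again.\<close>

lemma has_vector_derivative_in_closed_subspace:
  fixes f :: "real \<Rightarrow> 'b::real_normed_vector"
  assumes "subspace V" "closed V" "open U" "t \<in> U" "\<And>s. s \<in> U \<Longrightarrow> f s \<in> V"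
    and "(f has_vector_derivative f') (at t)"
  shows "f' \<in> V"
proof -
  have "\<forall>\<^sub>F s in at t. (f s - f t) /\<^sub>R (s - t) \<in> V"
    using eventually_at_in_open'[OF assms(3,4)]
    by eventually_elim (use assms in \<open>auto intro!: subspace_scale subspace_diff\<close>)
  then show ?thesis
    using assms(2,6) Lim_in_closed_set[of V _ "at t" f']
    by (auto simp: has_vector_derivative_iff_slope)
qed

section \<open>Iterated derivatives and smooth curves\<close>

lemma nth_deriv_0 [simp]: "nth_deriv 0 f = f"
  by (simp add: nth_deriv_def)

lemma nth_deriv_Suc: "nth_deriv (Suc k) f t = vector_derivative (nth_deriv k f) (at t)"
  by (simp add: nth_deriv_def)

text \<open>A formula at one point cannot be differentiated; it has to hold on an open
  neighbourhood. This is why later computations carry a whole set \<open>U\<close> although only the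
  value at one parameter matters.\<close>

lemma nth_deriv_Suc_eqI:
  assumes "open U" "t \<in> U" "\<And>s. s \<in> U \<Longrightarrow> nth_deriv k f s = g s"
    and "(g has_vector_derivative g') (at t)"
  shows "nth_deriv (Suc k) f t = g'"
  using has_vector_derivative_transform_within_open[OF assms(4,1,2), of "nth_deriv k f"] assms(3)
  by (simp add: nth_deriv_Suc vector_derivative_at)

lemma smooth_on_has_vector_derivative:
  assumes "smooth_on U f" "t \<in> U"
  shows "(nth_deriv k f has_vector_derivative nth_deriv (Suc k) f t) (at t)"
  using assms by (simp add: smooth_on_def nth_deriv_Suc vector_derivative_works)

lemma smooth_on_bounded_linear:
  assumes "bounded_linear h" "open U" "smooth_on U f"
  shows "smooth_on U (\<lambda>t. h (f t))"
proof -
  have eq: "nth_deriv k (\<lambda>t. h (f t)) t = h (nth_deriv k f t)" if "t \<in> U" for k t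
    using that
  proof (induction k arbitrary: t)
    case (Suc k)
    show ?case
      by (rule nth_deriv_Suc_eqI[OF assms(2) Suc.prems Suc.IH bounded_linear.has_vector_derivative
            [OF assms(1) smooth_on_has_vector_derivative[OF assms(3) Suc.prems]]])
  qed simp
  have "(nth_deriv k (\<lambda>t. h (f t)) has_vector_derivative h (nth_deriv (Suc k) f t)) (at t)"
    if "t \<in> U" for k t
    using has_vector_derivative_transform_within_open[OF bounded_linear.has_vector_derivative
        [OF assms(1) smooth_on_has_vector_derivative[OF assms(3) that]] assms(2) that eq[symmetric]] .
  then show ?thesis
    unfolding smooth_on_def by (blast intro: differentiableI_vector)
qed

lemma smooth_on_add_const:
  assumes "open U" "smooth_on U f"
  shows "smooth_on U (\<lambda>t. a + f t)"
proof -
  \<comment> \<open>The constant survives only in the derivative of order zero, hence the case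
    distinction.\<close>
  have eq: "nth_deriv k (\<lambda>t. a + f t) t = (if k = 0 then a else 0) + nth_deriv k f t" if "t \<in> U" for k t
    using that
  proof (induction k arbitrary: t)
    case (Suc k)
    have "((\<lambda>s. (if k = 0 then a else 0) + nth_deriv k f s) has_vector_derivative
        0 + nth_deriv (Suc k) f t) (at t)"
      by (intro has_vector_derivative_add has_vector_derivative_const
          smooth_on_has_vector_derivative[OF assms(2) Suc.prems])
    from nth_deriv_Suc_eqI[OF assms(1) Suc.prems Suc.IH this] show ?case by simp
  qed simp
  have "(nth_deriv k (\<lambda>t. a + f t) has_vector_derivative nth_deriv (Suc k) f t) (at t)"
    if "t \<in> U" for k t
    by (rule has_vector_derivative_transform_within_open[OF _ assms(1) that eq[symmetric]])
       (rule has_vector_derivative_eq_rhs[OF has_vector_derivative_add[OF has_vector_derivative_const[of "if k = 0 then a else 0"]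
          smooth_on_has_vector_derivative[OF assms(2) that, of k]]], simp)
  then show ?thesis
    unfolding smooth_on_def by (blast intro: differentiableI_vector)
qed

section \<open>Products and inverses of curves of operators\<close>

lemmas has_vector_derivative_compose_blinfun =
  bounded_bilinear.has_vector_derivative[OF bounded_bilinear_blinfun_compose]

text \<open>Everything follows from the resolvent identity
  \<open>Q s - Q t = - Q s (B s - B t) Q t\<close>. \<open>Q\<close> is given only pointwise, so the
  identity is used three times: to bound \<open>Q\<close> near \<open>t\<close>, then to get
  continuity, then to compute the slope.\<close>

lemma has_vector_derivative_inverse_blinfun:
  fixes B Q :: "real \<Rightarrow> ('a::real_normed_vector \<Rightarrow>\<^sub>L 'a)"
  assumes "open U" "t \<in> U" and inv: "\<And>s. s \<in> U \<Longrightarrow> Q s o\<^sub>L B s = id_blinfun"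
      "\<And>s. s \<in> U \<Longrightarrow> B s o\<^sub>L Q s = id_blinfun"
    and B: "(B has_vector_derivative B') (at t)"
  shows "(Q has_vector_derivative - (Q t o\<^sub>L B' o\<^sub>L Q t)) (at t)"
proof -
  have 1: "Q s (B s x) = x" "B s (Q s x) = x" if "s \<in> U" for s x
    using inv[OF that] by (metis blinfun_apply_blinfun_compose blinfun_apply_id_blinfun)+
  have diff: "Q s - Q t = - (Q s o\<^sub>L (B s - B t) o\<^sub>L Q t)" if "s \<in> U" for s
    using 1[OF that] 1[OF assms(2)] by (intro blinfun_eqI) (simp add: blinfun.bilinear_simps)
  have inU: "\<forall>\<^sub>F s in at t. s \<in> U"
    using assms by (simp add: eventually_at_in_open')
  have Bt: "(B \<longlongrightarrow> B t) (at t)"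
    using has_vector_derivative_continuous[OF B] by (simp add: continuous_within)
  define q where "q = norm (Q t)"
  have "((\<lambda>s. norm (B s - B t) * q) \<longlongrightarrow> norm (B t - B t) * q) (at t)"
    by (intro tendsto_intros Bt)
  \<comment> \<open>The threshold \<open>1/2\<close> lets the term \<open>norm (Q s) * (1/2)\<close>
    be absorbed on the left, giving \<open>norm (Q s) \<le> 2 * q\<close>.\<close>
  then have "\<forall>\<^sub>F s in at t. norm (B s - B t) * q < 1/2"
    by (intro order_tendstoD) auto
  with inU have bd: "\<forall>\<^sub>F s in at t. norm (Q s - Q t) \<le> 2 * q * (norm (B s - B t) * q)"
  proof eventually_elim
    case (elim s)
    have le: "norm (Q s - Q t) \<le> norm (Q s) * (norm (B s - B t) * q)"
    proof -
      have "norm (Q s - Q t) \<le> norm (Q s o\<^sub>L (B s - B t)) * q"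
        unfolding diff[OF elim(1)] norm_minus_cancel q_def by (rule norm_blinfun_compose)
      also have "\<dots> \<le> norm (Q s) * norm (B s - B t) * q"
        by (intro mult_right_mono norm_blinfun_compose) (simp add: q_def)
      finally show ?thesis by (simp add: mult.assoc)
    qed
    also have "\<dots> \<le> norm (Q s) * (1/2)"
      using elim by (intro mult_left_mono) auto
    finally have "norm (Q s) \<le> 2 * q"
      using norm_triangle_sub[of "Q s" "Q t"] by (simp add: q_def)
    then show ?case
      by (intro order_trans[OF le] mult_right_mono) (auto simp: q_def)
  qed
  have "((\<lambda>s. 2 * q * (norm (B s - B t) * q)) \<longlongrightarrow> 2 * q * (norm (B t - B t) * q)) (at t)"
    by (intro tendsto_intros Bt)
  then have "((\<lambda>s. Q s - Q t) \<longlongrightarrow> 0) (at t)"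
    by (intro Lim_null_comparison[OF bd]) simp
  then have Qt: "(Q \<longlongrightarrow> Q t) (at t)"
    by (simp add: LIM_zero_iff)
  have "((\<lambda>s. - (Q s o\<^sub>L ((B s - B t) /\<^sub>R (s - t)) o\<^sub>L Q t)) \<longlongrightarrow> - (Q t o\<^sub>L B' o\<^sub>L Q t)) (at t)"
    using B unfolding has_vector_derivative_iff_slope
    by (intro tendsto_minus bounded_bilinear.tendsto[OF bounded_bilinear_blinfun_compose] Qt) auto
  moreover have "\<forall>\<^sub>F s in at t. - (Q s o\<^sub>L ((B s - B t) /\<^sub>R (s - t)) o\<^sub>L Q t) = (Q s - Q t) /\<^sub>R (s - t)"
    using inU by eventually_elim
      (simp add: diff, intro blinfun_eqI, simp add: blinfun.bilinear_simps)
  ultimately show ?thesis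
    unfolding has_vector_derivative_iff_slope by (rule Lim_transform_eventually)
qed

text \<open>In finite dimension injectivity is enough, and a fixed vector of \<open>X\<close> must
  vanish because \<open>X\<close> contracts norms; no Neumann series has to be summed.\<close>

lemma id_minus_invertible:
  fixes X :: "'a::euclidean_space \<Rightarrow>\<^sub>L 'a"
  assumes "norm X < 1"
  obtains Q where "Q o\<^sub>L (id_blinfun - X) = id_blinfun" "(id_blinfun - X) o\<^sub>L Q = id_blinfun"
proof -
  let ?B = "id_blinfun - X"
  have "inj (blinfun_apply ?B)"
  proof (rule injI)
    fix x y assume "?B x = ?B y"
    then have "X (x - y) = x - y"
      by (simp add: blinfun.bilinear_simps algebra_simps)
    then have "norm (x - y) \<le> norm X * norm (x - y)"
      by (metis norm_blinfun)
    then show "x = y"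
      using assms mult_strict_right_mono[OF assms, of "norm (x - y)"] by (cases "x = y") auto
  qed
  moreover have lin: "linear (blinfun_apply ?B)"
    by (simp add: blinfun.bounded_linear_right bounded_linear.linear)
  ultimately obtain g where g: "linear g" "\<forall>x. g (?B x) = x" "\<forall>x. ?B (g x) = x"
    using linear_injective_isomorphism by blast
  then have bl: "bounded_linear g" by (simp add: linear_conv_bounded_linear)
  show ?thesis
    by (rule that[of "Blinfun g"])
      (use g bl in \<open>auto intro!: blinfun_eqI simp: bounded_linear_Blinfun_apply\<close>)
qed

text \<open>A local Gronwall argument that takes the place of uniqueness for linear differential
  equations. At a point \<open>m\<close> where \<open>norm (f t)\<close> is maximal on a small
  closed ball, the mean value inequality gives
  \<open>norm (f m) \<le> norm (f m) / 2\<close>.\<close>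

lemma linear_growth_bound_zero:
  fixes f :: "real \<Rightarrow> 'b::real_normed_vector"
  assumes "e > 0" and der: "\<And>t. \<bar>t - a\<bar> < e \<Longrightarrow> (f has_vector_derivative f' t) (at t)"
    and bd: "\<And>t. \<bar>t - a\<bar> < e \<Longrightarrow> norm (f' t) \<le> K * norm (f t)" and "f a = 0"
  obtains d where "0 < d" "d \<le> e" "\<And>t. \<bar>t - a\<bar> < d \<Longrightarrow> f t = 0"
proof -
  \<comment> \<open>The bound \<open>e / 2\<close> keeps the closed ball inside the domain of the
    hypotheses; the other makes \<open>\<bar>K\<bar> * d \<le> 1/2\<close>, also when
    \<open>K = 0\<close>.\<close>
  define d where "d = min (e / 2) (1 / (2 * (\<bar>K\<bar> + 1)))"
  have d: "0 < d" "d < e" "(\<bar>K\<bar> + 1) * d \<le> 1/2"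
    using assms(1) by (auto simp: d_def min_def field_simps)
  let ?C = "cball a d"
  have inC: "\<bar>t - a\<bar> < e" if "t \<in> ?C" for t
    using that d by (auto simp: dist_real_def)
  have "continuous_on ?C f"
    using has_vector_derivative_continuous[OF der[OF inC]]
    by (simp add: continuous_at_imp_continuous_on)
  then have "continuous_on ?C (\<lambda>t. norm (f t))"
    by (rule continuous_on_norm)
  moreover have "compact ?C" "?C \<noteq> {}" using d by auto
  ultimately obtain m where m: "m \<in> ?C" "\<And>t. t \<in> ?C \<Longrightarrow> norm (f t) \<le> norm (f m)"
    using continuous_attains_sup[of ?C "\<lambda>t. norm (f t)"] by blast
  have "norm (f t - f a) \<le> (\<bar>K\<bar> * norm (f m)) * norm (t - a)" if t: "t \<in> ?C" for t
  proof (rule differentiable_bound[of ?C f "\<lambda>t h. h *\<^sub>R f' t"])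
    fix s assume s: "s \<in> ?C"
    show "(f has_derivative (\<lambda>h. h *\<^sub>R f' s)) (at s within ?C)"
      using der[OF inC[OF s]] has_vector_derivative_at_within
      unfolding has_vector_derivative_def by blast
    have "norm (f' s) \<le> \<bar>K\<bar> * norm (f m)"
      using bd[OF inC[OF s]] m(2)[OF s]
      by (meson abs_ge_self abs_ge_zero mult_mono norm_ge_zero order_trans)
    then show "onorm (\<lambda>h. h *\<^sub>R f' s) \<le> \<bar>K\<bar> * norm (f m)"
      by (intro onorm_bound) (auto simp: mult.commute mult_left_mono)
  qed (use t d in auto)
  from this[OF m(1)] have "norm (f m) \<le> \<bar>K\<bar> * norm (f m) * \<bar>m - a\<bar>"
    using assms(4) by simp
  also have "\<dots> \<le> \<bar>K\<bar> * norm (f m) * d"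
    using m(1) by (intro mult_left_mono) (auto simp: dist_real_def)
  also have "\<dots> \<le> norm (f m) * (1/2)"
  proof -
    have "\<bar>K\<bar> * d \<le> 1/2" using d by (simp add: distrib_right)
    from mult_left_mono[OF this, of "norm (f m)"] show ?thesis by (simp add: ac_simps)
  qed
  finally have "f m = 0" by simp
  then show ?thesis
    using m(2) d that[of d] by (simp add: dist_real_def abs_minus_commute)
qed

section \<open>Transverse Lagrangian subspaces\<close>

locale symplectic =
  fixes \<omega> :: "'a::euclidean_space \<Rightarrow> 'a \<Rightarrow> real"
  assumes symplectic: "symplectic_form \<omega>"
begin

lemma bilinear: "bilinear \<omega>"
  using symplectic by (simp add: symplectic_form_def)

lemmas omega_simps =
  bilinear_ladd[OF bilinear] bilinear_radd[OF bilinear] bilinear_lsub[OF bilinear]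
  bilinear_rsub[OF bilinear] bilinear_lmul[OF bilinear] bilinear_rmul[OF bilinear]
  bilinear_lzero[OF bilinear] bilinear_rzero[OF bilinear]

lemma omega_self [simp]: "\<omega> u u = 0"
  using symplectic by (simp add: symplectic_form_def)

lemma omega_nondegenerate: "(\<And>v. \<omega> u v = 0) \<Longrightarrow> u = 0"
  using symplectic by (auto simp: symplectic_form_def)

text \<open>Nondegeneracy identifies vectors with functionals, so a nonzero normal vector to
  \<open>V\<close> would represent some \<open>\<omega> x\<close> with \<open>x\<close>
  symplectically orthogonal to \<open>V\<close>. This serves instead of counting dimensions of
  Lagrangian subspaces.\<close>

lemma subspace_eq_UNIV:
  assumes "subspace V" and "\<And>x. (\<And>v. v \<in> V \<Longrightarrow> \<omega> x v = 0) \<Longrightarrow> x = 0"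
  shows "V = UNIV"
proof (rule ccontr)
  assume "V \<noteq> UNIV"
  then obtain a where a: "a \<noteq> 0" "\<And>x. x \<in> V \<Longrightarrow> a \<bullet> x = 0"
    using span_not_UNIV_orthogonal[of V] span_eq_iff[of V] assms(1) by metis
  \<comment> \<open>\<open>j x\<close> is the Riesz representative of the functional
    \<open>\<omega> x\<close>.\<close>
  define j where "j x = (\<Sum>b\<in>Basis. \<omega> x b *\<^sub>R b)" for x
  have j: "j x \<bullet> v = \<omega> x v" for x v
  proof -
    have "linear (\<omega> x)" using bilinear by (simp add: bilinear_def)
    then have "\<omega> x v = (\<Sum>b\<in>Basis. (v \<bullet> b) * \<omega> x b)"
      by (subst euclidean_representation[symmetric, of v])
        (simp add: linear_sum linear_cmul)
    then show ?thesis
      by (simp add: j_def inner_sum_left inner_commute[of v] mult.commute)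
  qed
  have "linear j"
    by (rule linearI) (simp_all add: j_def omega_simps scaleR_left_distrib sum.distrib scaleR_sum_right)
  moreover have "inj j"
    unfolding linear_inj_iff_eq_0[OF \<open>linear j\<close>]
    by (metis inner_zero_left j omega_nondegenerate)
  ultimately have "surj j"
    by (simp add: linear_injective_imp_surjective)
  then obtain x where x: "a = j x" by (metis surjD)
  then have "x = 0"
    using a(2) j by (intro assms(2)) (metis)
  then show False
    using a(1) x \<open>linear j\<close> linear_0 by blast
qed

lemma lagrangian_subspace: "lagrangian \<omega> A \<Longrightarrow> subspace A"
  by (simp add: lagrangian_def)

lemma lagrangian_isotropic: "lagrangian \<omega> A \<Longrightarrow> u \<in> A \<Longrightarrow> v \<in> A \<Longrightarrow> \<omega> u v = 0"
  by (auto simp: lagrangian_def)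

lemma lagrangian_memI: "lagrangian \<omega> A \<Longrightarrow> (\<And>v. v \<in> A \<Longrightarrow> \<omega> u v = 0) \<Longrightarrow> u \<in> A"
  by (auto simp: lagrangian_def)

text \<open>A symmetric form of membership in \<open>transversals\<close>: charts are needed both
  over \<open>A\<close> along \<open>D\<close> and over \<open>D\<close> along
  \<open>A\<close>.\<close>

definition transverse :: "'a set \<Rightarrow> 'a set \<Rightarrow> bool" where
  "transverse A D \<longleftrightarrow> lagrangian \<omega> A \<and> lagrangian \<omega> D \<and> A \<inter> D = {0}"

lemma transverse_sym: "transverse A D \<Longrightarrow> transverse D A"
  by (auto simp: transverse_def)

lemma transversals_iff: "lagrangian \<omega> D \<Longrightarrow> A \<in> transversals \<omega> D \<longleftrightarrow> transverse A D"
  by (auto simp: transverse_def transversals_def)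

lemma transverse_Int: "transverse A D \<Longrightarrow> x \<in> A \<Longrightarrow> x \<in> D \<Longrightarrow> x = 0"
  by (auto simp: transverse_def)

text \<open>A vector symplectically orthogonal to \<open>A + D\<close> is orthogonal to each
  summand, hence lies in both Lagrangian subspaces and is zero.\<close>

lemma transverse_sum:
  assumes "transverse A D"
  obtains a d where "a \<in> A" "d \<in> D" "x = a + d"
proof -
  have AD: "lagrangian \<omega> A" "lagrangian \<omega> D" using assms by (auto simp: transverse_def)
  let ?V = "{a + d | a d. a \<in> A \<and> d \<in> D}"
  have "subspace ?V"
    using AD by (intro subspace_sums) (auto simp: lagrangian_def)
  moreover have "x = 0" if "\<And>v. v \<in> ?V \<Longrightarrow> \<omega> x v = 0" for x
  proof -
    have "0 \<in> A" "0 \<in> D" using AD by (auto simp: lagrangian_def subspace_0)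
    have "\<omega> x v = 0" if "v \<in> A" for v
      using \<open>\<And>v. v \<in> ?V \<Longrightarrow> \<omega> x v = 0\<close>[of v] that \<open>0 \<in> D\<close> by force
    moreover have "\<omega> x v = 0" if "v \<in> D" for v
      using \<open>\<And>v. v \<in> ?V \<Longrightarrow> \<omega> x v = 0\<close>[of v] that \<open>0 \<in> A\<close> by force
    ultimately show ?thesis
      using lagrangian_memI[OF AD(1)] lagrangian_memI[OF AD(2)] transverse_Int[OF assms] by blast
  qed
  ultimately have "?V = UNIV" by (rule subspace_eq_UNIV)
  then show ?thesis using that by blast
qed

lemma transverse_projection:
  assumes "transverse A D"
  obtains p :: "'a \<Rightarrow>\<^sub>L 'a" where "\<And>x. p x \<in> A" "\<And>x. x - p x \<in> D"
    "\<And>x. x \<in> A \<Longrightarrow> p x = x" "\<And>x. x \<in> D \<Longrightarrow> p x = 0"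
proof -
  have sA: "subspace A" and sD: "subspace D"
    using assms by (auto simp: transverse_def lagrangian_def)
  have "\<exists>a. a \<in> A \<and> x - a \<in> D" for x
    using transverse_sum[OF assms, of x] by (metis add_diff_cancel_left')
  then obtain p where p: "\<And>x. p x \<in> A" "\<And>x. x - p x \<in> D" by metis
  have uniq: "p x = a" if "a \<in> A" "x - a \<in> D" for x a
  proof -
    have "p x - a \<in> A" using p that sA by (simp add: subspace_diff)
    moreover have "(x - a) - (x - p x) \<in> D" by (rule subspace_diff[OF sD that(2) p(2)])
    ultimately show ?thesis using transverse_Int[OF assms, of "p x - a"] by simp
  qed
  have "linear p"
  proof (rule linearI)
    fix x y c
    have "(x - p x) + (y - p y) \<in> D" "c *\<^sub>R (x - p x) \<in> D"
      using p sD by (auto intro: subspace_add subspace_scale)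
    then show "p (x + y) = p x + p y" "p (c *\<^sub>R x) = c *\<^sub>R p x"
      using p sA by (auto intro!: uniq subspace_add subspace_scale simp: algebra_simps)
  qed
  then have ap: "blinfun_apply (Blinfun p) = p"
    by (simp add: bounded_linear_Blinfun_apply linear_conv_bounded_linear)
  show ?thesis
    by (rule that[of "Blinfun p"])
      (use p uniq sA sD in \<open>auto simp: ap subspace_0\<close>)
qed

section \<open>Graphs, chart maps and symplectic shears\<close>

lemma graph_over_image: "graph_over A S = (\<lambda>u. u + blinfun_apply S u) ` A"
  by (auto simp: graph_over_def)

lemma chart_maps_in:
  assumes "transverse A D" "S \<in> chart_maps \<omega> A D"
  shows "blinfun_apply S x \<in> D"
proof -
  obtain a d where "a \<in> A" "d \<in> D" "x = a + d" using transverse_sum[OF assms(1)] .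
  then show ?thesis using assms(2) by (simp add: chart_maps_def blinfun.bilinear_simps)
qed

lemma chart_maps_zero: "S \<in> chart_maps \<omega> A D \<Longrightarrow> x \<in> D \<Longrightarrow> blinfun_apply S x = 0"
  by (simp add: chart_maps_def)

text \<open>Values lie in \<open>D\<close>, where chart maps vanish. Hence \<open>1 + S\<close> has
  inverse \<open>1 - S\<close>, and shears along the same \<open>D\<close> compose by adding their
  chart maps.\<close>

lemma chart_maps_square:
  "transverse A D \<Longrightarrow> S \<in> chart_maps \<omega> A D \<Longrightarrow> T \<in> chart_maps \<omega> A D \<Longrightarrow>
   blinfun_apply S (blinfun_apply T x) = 0"
  by (simp add: chart_maps_in chart_maps_zero)

text \<open>The extension by zero keeps skewness on the whole space, because the additional terms
  pair two vectors of the isotropic \<open>D\<close>. So chart maps are infinitesimal symplectic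
  maps.\<close>

lemma chart_maps_skew:
  assumes "transverse A D" "S \<in> chart_maps \<omega> A D"
  shows "\<omega> (blinfun_apply S x) y + \<omega> x (blinfun_apply S y) = 0"
proof -
  obtain a d where x: "a \<in> A" "d \<in> D" "x = a + d" using transverse_sum[OF assms(1)] .
  obtain a' d' where y: "a' \<in> A" "d' \<in> D" "y = a' + d'" using transverse_sum[OF assms(1)] .
  have "\<omega> (S a) d' = 0" "\<omega> d (S a') = 0"
    using lagrangian_isotropic[of D] assms x y chart_maps_in[OF assms] by (auto simp: transverse_def)
  moreover have "\<omega> (S a) a' + \<omega> a (S a') = 0" using x y assms(2) by (simp add: chart_maps_def)
  ultimately show ?thesis
    using chart_maps_zero[OF assms(2)] x y by (simp add: blinfun.bilinear_simps omega_simps)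
qed

text \<open>The linear terms cancel by skewness and the quadratic term pairs two vectors of
  \<open>D\<close>. The shear \<open>1 + S\<close> can thus transport Lagrangian and transverse
  subspaces.\<close>

lemma chart_maps_symplectic:
  assumes "transverse A D" "S \<in> chart_maps \<omega> A D"
  shows "\<omega> (x + blinfun_apply S x) (y + blinfun_apply S y) = \<omega> x y"
proof -
  have "\<omega> (S x) (S y) = 0"
    using lagrangian_isotropic[of D] assms chart_maps_in[OF assms] by (auto simp: transverse_def)
  then show ?thesis using chart_maps_skew[OF assms, of x y] by (simp add: omega_simps)
qed

lemma lagrangian_image:
  assumes "lagrangian \<omega> A" "linear g" "\<And>x y. \<omega> (g x) (g y) = \<omega> x y"
  shows "lagrangian \<omega> (g ` A)"
proof -
  have "inj g"
    unfolding linear_inj_iff_eq_0[OF assms(2)]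
    by (metis assms(3) omega_nondegenerate omega_simps(7))
  then have "surj g" using assms(2) by (simp add: linear_injective_imp_surjective)
  have "x \<in> g ` A" if x: "\<forall>v\<in>g ` A. \<omega> x v = 0" for x
  proof -
    obtain y where y: "x = g y" using \<open>surj g\<close> by (metis surjD)
    then have "y \<in> A" using x assms(3) by (intro lagrangian_memI[OF assms(1)]) auto
    then show ?thesis using y by simp
  qed
  moreover have "\<omega> x v = 0" if "x \<in> g ` A" "v \<in> g ` A" for x v
    using that assms(3) lagrangian_isotropic[OF assms(1)] by auto
  moreover have "subspace (g ` A)"
    using lagrangian_subspace[OF assms(1)] by (rule linear_subspace_image[OF assms(2)])
  ultimately show ?thesis
    unfolding lagrangian_def by blast
qed

lemma transverse_image:
  assumes "transverse A D" "linear g" "\<And>x y. \<omega> (g x) (g y) = \<omega> x y"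
  shows "transverse (g ` A) (g ` D)"
proof -
  have "inj g"
    unfolding linear_inj_iff_eq_0[OF assms(2)]
    by (metis assms(3) omega_nondegenerate omega_simps(7))
  then have "g ` A \<inter> g ` D = {0}"
    using assms(1) linear_0[OF assms(2)] image_Int[of g A D] by (simp add: transverse_def)
  then show ?thesis
    using assms lagrangian_image by (simp add: transverse_def)
qed

text \<open>Expanding \<open>\<omega>\<close> on two vectors of the graph leaves only the mixed
  terms, since \<open>A\<close> and \<open>D\<close> are isotropic; isotropy of the graph is
  therefore skewness of \<open>S\<close>.\<close>

lemma chart_mapsI:
  assumes "transverse A D" "lagrangian \<omega> (graph_over A S)"
    "\<And>x. x \<in> D \<Longrightarrow> blinfun_apply S x = 0" "\<And>x. x \<in> A \<Longrightarrow> blinfun_apply S x \<in> D"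
  shows "S \<in> chart_maps \<omega> A D"
proof -
  have "\<omega> (S u) v + \<omega> u (S v) = 0" if "u \<in> A" "v \<in> A" for u v
  proof -
    have "\<omega> (u + S u) (v + S v) = 0"
      using assms(2) that by (intro lagrangian_isotropic) (auto simp: graph_over_def)
    moreover have "\<omega> (S u) (S v) = 0" "\<omega> u v = 0"
      using lagrangian_isotropic assms that by (auto simp: transverse_def)
    ultimately show ?thesis by (simp add: omega_simps)
  qed
  then show ?thesis using assms by (auto simp: chart_maps_def)
qed

lemma chart_map_unique:
  assumes "transverse A D" "S \<in> chart_maps \<omega> A D" "T \<in> chart_maps \<omega> A D"
    and "graph_over A S = graph_over A T"
  shows "S = T"
proof (rule blinfun_eqI)
  fix x
  obtain a d where x: "a \<in> A" "d \<in> D" "x = a + d" using transverse_sum[OF assms(1)] .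
  have "a + S a \<in> graph_over A T" using x assms(4) by (auto simp: graph_over_def)
  then obtain a' where a': "a' \<in> A" "a + S a = a' + T a'" by (auto simp: graph_over_def)
  have sub: "subspace A" "subspace D" using assms(1) by (auto simp: transverse_def lagrangian_def)
  have "a - a' = T a' - S a" using a'(2) by (simp add: algebra_simps)
  moreover have "a - a' \<in> A" "T a' - S a \<in> D"
    using sub x a' chart_maps_in assms by (auto intro: subspace_diff)
  ultimately have "a = a'" using transverse_Int[OF assms(1), of "a - a'"] by simp
  then show "S x = T x"
    using a' x assms chart_maps_zero by (simp add: blinfun.bilinear_simps)
qed

lemma chart_map_exists:
  assumes "transverse A D" "transverse B D"
  obtains S where "S \<in> chart_maps \<omega> A D" "graph_over A S = B"
proof -
  obtain p :: "'a \<Rightarrow>\<^sub>L 'a" where p: "\<And>x. p x \<in> A" "\<And>x. x - p x \<in> D"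
    "\<And>x. x \<in> A \<Longrightarrow> p x = x" "\<And>x. x \<in> D \<Longrightarrow> p x = 0"
    using transverse_projection[OF assms(1)] by blast
  obtain q :: "'a \<Rightarrow>\<^sub>L 'a" where q: "\<And>x. q x \<in> B" "\<And>x. x - q x \<in> D"
    "\<And>x. x \<in> B \<Longrightarrow> q x = x" "\<And>x. x \<in> D \<Longrightarrow> q x = 0"
    using transverse_projection[OF assms(2)] by blast
  \<comment> \<open>For \<open>a\<close> in \<open>A\<close>, \<open>q a\<close> is the point of
    \<open>B\<close> in the coset \<open>a + D\<close>, so \<open>q a - a\<close> is the value of
    the map; precomposing with \<open>p\<close> extends it by zero on \<open>D\<close>.\<close>
  let ?S = "(q - id_blinfun) o\<^sub>L p"
  have sD: "subspace D" using assms by (simp add: transverse_def lagrangian_def)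
  have Sa: "a + ?S a = q a" if "a \<in> A" for a
    using that p by (simp add: blinfun.bilinear_simps)
  have "b \<in> graph_over A ?S" if "b \<in> B" for b
  proof -
    have "q b - q (p b) = 0" using q(4)[OF p(2), of b] by (simp only: blinfun.diff_right)
    then have "p b + ?S (p b) = b" using Sa[OF p(1)] q(3)[OF that] by simp
    moreover have "p b + ?S (p b) \<in> graph_over A ?S" using p(1) unfolding graph_over_def by blast
    ultimately show ?thesis by simp
  qed
  then have gr: "graph_over A ?S = B"
    using Sa q(1) by (auto simp: graph_over_image)
  moreover have "?S \<in> chart_maps \<omega> A D"
  proof (rule chart_mapsI[OF assms(1)])
    show "lagrangian \<omega> (graph_over A ?S)" using gr assms by (simp add: transverse_def)
    show "?S x \<in> D" if "x \<in> A" for x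
      using subspace_neg[OF sD q(2)[of x]] that p by (simp add: blinfun.bilinear_simps)
  qed (use p in \<open>simp add: blinfun.bilinear_simps\<close>)
  ultimately show ?thesis using that by blast
qed

lemma chart_eqI:
  assumes "transverse A D" "S \<in> chart_maps \<omega> A D" "graph_over A S = B"
  shows "chart \<omega> A D B = S"
  unfolding chart_def using assms chart_map_unique[OF assms(1)] by (intro the_equality) auto

lemma chart_works:
  assumes "transverse A D" "transverse B D"
  shows "chart \<omega> A D B \<in> chart_maps \<omega> A D" "graph_over A (chart \<omega> A D B) = B"
  using chart_map_exists[OF assms] chart_eqI[OF assms(1)] by metis+

lemma linear_id_plus_blinfun: "linear (\<lambda>x. x + blinfun_apply S x)"
  by (rule linearI) (simp_all add: blinfun.bilinear_simps algebra_simps)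

lemma transverse_graph:
  assumes "transverse A D" "S \<in> chart_maps \<omega> A D"
  shows "transverse (graph_over A S) D"
proof -
  have "(\<lambda>x. x + S x) ` D = D" using chart_maps_zero[OF assms(2)] by auto
  then show ?thesis
    using transverse_image[OF assms(1) linear_id_plus_blinfun chart_maps_symplectic[OF assms]]
    by (simp add: graph_over_image)
qed

lemma subspace_chart_maps:
  assumes "subspace D"
  shows "subspace (chart_maps \<omega> A D)"
proof -
  have "\<omega> (c *\<^sub>R u) v + \<omega> u' (c *\<^sub>R v') = 0" if "\<omega> u v + \<omega> u' v' = 0" for c u v u' v'
    using that by (metis distrib_left mult_zero_right omega_simps(5,6) real_scaleR_def)
  then show ?thesis using assms
    by (fastforce intro!: subspaceI simp: chart_maps_def blinfun.bilinear_simps omega_simps subspace_0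
      intro: subspace_add subspace_scale)
qed

lemma closed_chart_maps:
  assumes "subspace D"
  shows "closed (chart_maps \<omega> A D)"
proof -
  have "bounded_bilinear \<omega>"
    using bilinear by (simp add: bilinear_conv_bounded_bilinear)
  then have "closed {S :: 'a \<Rightarrow>\<^sub>L 'a. \<omega> (blinfun_apply S u) v + \<omega> u (blinfun_apply S v) = 0}" for u v
    by (intro closed_Collect_eq continuous_intros bounded_bilinear.continuous_on[OF \<open>bounded_bilinear \<omega>\<close>])
  moreover have "closed {S :: 'a \<Rightarrow>\<^sub>L 'a. blinfun_apply S u = 0}" for u
    by (intro closed_Collect_eq continuous_intros)
  moreover have "closed {S :: 'a \<Rightarrow>\<^sub>L 'a. blinfun_apply S u \<in> D}" for u
    using continuous_closed_vimage[OF closed_subspace[OF assms], of "\<lambda>S :: 'a \<Rightarrow>\<^sub>L 'a. blinfun_apply S u"]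
    by (simp add: vimage_def continuous_intros)
  ultimately show ?thesis
    unfolding chart_maps_def Collect_conj_eq Collect_ball_eq
    by (intro closed_Int closed_INT ballI)
qed

text \<open>Surjectivity of \<open>T\<close> from \<open>A\<close> onto \<open>D\<close> comes from
  \<open>T(A) + A\<close> being everything: a vector orthogonal to it lies in \<open>A\<close>, and
  by skewness \<open>T\<close> sends it into \<open>A\<close> as well as \<open>D\<close>, hence to
  zero.\<close>

lemma chart_map_inverse:
  assumes "transverse A D" "T \<in> chart_maps \<omega> A D" "\<And>x. x \<in> A \<Longrightarrow> blinfun_apply T x = 0 \<Longrightarrow> x = 0"
  obtains R where "R \<in> chart_maps \<omega> D A" "\<And>x. x \<in> A \<Longrightarrow> blinfun_apply R (blinfun_apply T x) = x"
    "\<And>x. x \<in> D \<Longrightarrow> blinfun_apply T (blinfun_apply R x) = x"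
proof -
  have sub: "subspace A" "subspace D" and lag: "lagrangian \<omega> A"
    using assms(1) by (auto simp: transverse_def lagrangian_def)
  let ?V = "{x + y | x y. x \<in> blinfun_apply T ` A \<and> y \<in> A}"
  have V: "?V = UNIV"
  proof (rule subspace_eq_UNIV)
    show "subspace ?V"
      using sub by (intro subspace_sums linear_subspace_image)
        (auto simp: blinfun.bounded_linear_right bounded_linear.linear)
    fix x assume x: "\<And>v. v \<in> ?V \<Longrightarrow> \<omega> x v = 0"
    have T0: "T 0 = 0" by (simp add: blinfun.zero_right)
    have xA: "x \<in> A"
    proof (rule lagrangian_memI[OF lag])
      fix v assume "v \<in> A"
      then have "T 0 + v \<in> ?V" using subspace_0[OF sub(1)] by blast
      then show "\<omega> x v = 0" using x T0 by simp
    qed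
    have "\<omega> (T x) v = 0" if "v \<in> A" for v
    proof -
      have "T v + 0 \<in> ?V" using that subspace_0[OF sub(1)] by blast
      then have "\<omega> x (T v) = 0" using x by simp
      then show ?thesis using chart_maps_skew[OF assms(1,2), of x v] by simp
    qed
    then have "T x \<in> A" by (rule lagrangian_memI[OF lag])
    then have "T x = 0" using chart_maps_in[OF assms(1,2)] transverse_Int[OF assms(1)] by blast
    then show "x = 0" using assms(3) xA by blast
  qed
  \<comment> \<open>The condition says that \<open>T a\<close> is the \<open>D\<close>-component of
    \<open>x\<close>, so the map \<open>r\<close> chosen from it inverts \<open>T\<close> and is
    already extended by zero on \<open>A\<close>.\<close>
  have "\<exists>a. a \<in> A \<and> x - T a \<in> A" for x
  proof -
    have "x \<in> ?V" using V by simp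
    then obtain a y where "a \<in> A" "y \<in> A" "x = T a + y" by blast
    then show ?thesis by (intro exI[of _ a]) simp
  qed
  then obtain r where r: "\<And>x. r x \<in> A" "\<And>x. x - T (r x) \<in> A" by metis
  have uniq: "r x = a" if "a \<in> A" "x - T a \<in> A" for x a
  proof -
    have "(x - T a) - (x - T (r x)) \<in> A" by (rule subspace_diff[OF sub(1) that(2) r(2)])
    moreover have "(x - T a) - (x - T (r x)) = T (r x - a)" by (simp add: blinfun.diff_right)
    ultimately have "T (r x - a) = 0"
      using transverse_Int[OF assms(1), of "T (r x - a)"] chart_maps_in[OF assms(1,2)] by simp
    then show ?thesis using assms(3)[of "r x - a"] subspace_diff[OF sub(1) r(1) that(1)] by simp
  qed
  have "linear r"
  proof (rule linearI)
    fix x y c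
    have "(x - T (r x)) + (y - T (r y)) \<in> A" "c *\<^sub>R (x - T (r x)) \<in> A"
      using r sub by (auto intro: subspace_add subspace_scale)
    then show "r (x + y) = r x + r y" "r (c *\<^sub>R x) = c *\<^sub>R r x"
      using r sub by (auto intro!: uniq subspace_add subspace_scale
          simp: algebra_simps blinfun.bilinear_simps)
  qed
  then have ap: "blinfun_apply (Blinfun r) = r"
    by (simp add: bounded_linear_Blinfun_apply linear_conv_bounded_linear)
  have rT: "r (T x) = x" if "x \<in> A" for x
    using that sub by (intro uniq) (auto simp: subspace_0)
  have Tr: "T (r x) = x" if "x \<in> D" for x
    using transverse_Int[OF assms(1) r(2)[of x]] chart_maps_in[OF assms(1,2)] that
    by (simp add: subspace_diff sub)
  have "Blinfun r \<in> chart_maps \<omega> D A"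
  proof -
    have "r x = 0" if "x \<in> A" for x
      using that sub by (intro uniq) (auto simp: subspace_0 blinfun.zero_right)
    moreover have "\<omega> (r u) v + \<omega> u (r v) = 0" if "u \<in> D" "v \<in> D" for u v
      using chart_maps_skew[OF assms(1,2), of "r u" "r v"] Tr that by simp
    ultimately show ?thesis using r(1) by (simp add: chart_maps_def ap)
  qed
  then show ?thesis using that[of "Blinfun r"] rT Tr by (simp add: ap)
qed

end

section \<open>Derivative element and curvature in a chart\<close>

text \<open>The curvature sees the curve to third order, so three derivatives are carried along. The
  assumption \<open>regular\<close> is nondegeneracy of the velocity form, read in the
  chart.\<close>

locale jacobi_chart = symplectic \<omega> for \<omega> :: "'a::euclidean_space \<Rightarrow> 'a \<Rightarrow> real" +
  fixes A D :: "'a set" and J :: "real set" and \<Gamma> :: "real \<Rightarrow> 'a set"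
    and S S1 S2 S3 :: "real \<Rightarrow> 'a \<Rightarrow>\<^sub>L 'a"
  assumes trans: "transverse A D" and open_J: "open J"
    and S: "\<And>t. t \<in> J \<Longrightarrow> S t \<in> chart_maps \<omega> A D"
    and graph: "\<And>t. t \<in> J \<Longrightarrow> graph_over A (S t) = \<Gamma> t"
    and deriv_S: "\<And>t. t \<in> J \<Longrightarrow> (S has_vector_derivative S1 t) (at t)"
    and deriv_S1: "\<And>t. t \<in> J \<Longrightarrow> (S1 has_vector_derivative S2 t) (at t)"
    and deriv_S2: "\<And>t. t \<in> J \<Longrightarrow> (S2 has_vector_derivative S3 t) (at t)"
    and regular: "\<And>t x. t \<in> J \<Longrightarrow> x \<in> A \<Longrightarrow> S1 t x = 0 \<Longrightarrow> x = 0"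
begin

lemma subspaces: "subspace A" "subspace D"
  using trans by (auto simp: transverse_def lagrangian_def)

lemma derivatives_chart_maps:
  assumes "t \<in> J"
  shows "S1 t \<in> chart_maps \<omega> A D" "S2 t \<in> chart_maps \<omega> A D" "S3 t \<in> chart_maps \<omega> A D"
proof -
  note * = has_vector_derivative_in_closed_subspace[OF subspace_chart_maps[OF subspaces(2)]
      closed_chart_maps[OF subspaces(2)] open_J]
  have 1: "S1 t \<in> chart_maps \<omega> A D" if "t \<in> J" for t
    by (rule *[OF that S deriv_S[OF that]])
  have 2: "S2 t \<in> chart_maps \<omega> A D" if "t \<in> J" for t
    by (rule *[OF that 1 deriv_S1[OF that]])
  show "S1 t \<in> chart_maps \<omega> A D" "S2 t \<in> chart_maps \<omega> A D" "S3 t \<in> chart_maps \<omega> A D"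
    using 1 2 *[OF assms 2 deriv_S2[OF assms]] assms by auto
qed

text \<open>
  \<open>frame \<tau> b\<close> is a symplectic isomorphism with inverse \<open>frame_inv \<tau> b\<close>; it maps \<open>A\<close> to \<open>\<Gamma> \<tau>\<close>, and as \<open>b\<close>
  varies the image of \<open>D\<close> runs through all Lagrangian subspaces transverse to \<open>\<Gamma> \<tau>\<close>.
\<close>

definition frame :: "real \<Rightarrow> ('a \<Rightarrow>\<^sub>L 'a) \<Rightarrow> 'a \<Rightarrow>\<^sub>L 'a" where
  "frame \<tau> b = (id_blinfun + S \<tau>) o\<^sub>L (id_blinfun + b)"

definition frame_inv :: "real \<Rightarrow> ('a \<Rightarrow>\<^sub>L 'a) \<Rightarrow> 'a \<Rightarrow>\<^sub>L 'a" where
  "frame_inv \<tau> b = (id_blinfun - b) o\<^sub>L (id_blinfun - S \<tau>)"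

context
  fixes \<tau> b
  assumes \<tau>: "\<tau> \<in> J" and b: "b \<in> chart_maps \<omega> D A"
begin

lemma b_simps:
  "blinfun_apply b x \<in> A" "x \<in> A \<Longrightarrow> b x = 0" "b (b x) = 0"
  using chart_maps_in[OF transverse_sym[OF trans] b] chart_maps_zero[OF b] by auto

lemma S_simps:
  "t \<in> J \<Longrightarrow> S t x \<in> D" "t \<in> J \<Longrightarrow> x \<in> D \<Longrightarrow> S t x = 0" "s \<in> J \<Longrightarrow> t \<in> J \<Longrightarrow> S s (S t x) = 0"
  using chart_maps_in[OF trans S] chart_maps_zero[OF S] by auto

lemma frame_inverse: "frame \<tau> b (frame_inv \<tau> b x) = x" "frame_inv \<tau> b (frame \<tau> b x) = x"
  unfolding frame_def frame_inv_def using b_simps S_simps \<tau>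
  by (simp_all add: blinfun.bilinear_simps)

lemma frame_symplectic: "\<omega> (frame \<tau> b x) (frame \<tau> b y) = \<omega> x y"
  unfolding frame_def
  using chart_maps_symplectic[OF trans S[OF \<tau>]] chart_maps_symplectic[OF transverse_sym[OF trans] b]
  by (simp add: blinfun.add_left)

lemma frame_image: "frame \<tau> b ` A = \<Gamma> \<tau>"
proof -
  have "frame \<tau> b x = x + S \<tau> x" if "x \<in> A" for x
    using that b_simps by (simp add: frame_def blinfun.bilinear_simps)
  then show ?thesis using graph[OF \<tau>] by (auto simp: graph_over_image)
qed

lemma transverse_frame: "transverse (\<Gamma> \<tau>) (frame \<tau> b ` D)"
  unfolding frame_image[symmetric]
  by (rule transverse_image[OF trans _ frame_symplectic])
    (simp add: blinfun.bounded_linear_right bounded_linear.linear)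

text \<open>Transport of structure along the symplectic frame; it later turns \<open>S1 t0\<close>
  into the direction of the local line.\<close>

lemma conjugate_chart_maps:
  assumes "T \<in> chart_maps \<omega> A D"
  shows "frame \<tau> b o\<^sub>L T o\<^sub>L frame_inv \<tau> b \<in> chart_maps \<omega> (\<Gamma> \<tau>) (frame \<tau> b ` D)"
  using chart_maps_zero[OF assms] chart_maps_in[OF trans assms] chart_maps_skew[OF trans assms]
  by (auto simp: chart_maps_def frame_image[symmetric] frame_inverse frame_symplectic
      blinfun.zero_right)

text \<open>With \<open>E = S t - S \<tau>\<close>, the inverse frame sends \<open>v + S t v\<close>
  to \<open>(v - b (E v)) + E v\<close>, split into its \<open>A\<close> and \<open>D\<close>
  components. Hence the moved curve is the graph of \<open>E (1 - b E)^-1\<close>. Near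
  \<open>\<tau>\<close> the operator \<open>b E\<close> has norm below \<open>1\<close>, and
  \<open>Q t\<close> is the inverse of \<open>1 - b E\<close>.\<close>

lemma chart_near:
  obtains U Q where "open U" "\<tau> \<in> U" "U \<subseteq> J" "Q \<tau> = id_blinfun"
    "\<And>t. t \<in> U \<Longrightarrow> Q t o\<^sub>L (id_blinfun - (b o\<^sub>L (S t - S \<tau>))) = id_blinfun"
    "\<And>t. t \<in> U \<Longrightarrow> (id_blinfun - (b o\<^sub>L (S t - S \<tau>))) o\<^sub>L Q t = id_blinfun"
    "\<And>t. t \<in> U \<Longrightarrow> chart \<omega> (\<Gamma> \<tau>) (frame \<tau> b ` D) (\<Gamma> t) =
        frame \<tau> b o\<^sub>L ((S t - S \<tau>) o\<^sub>L Q t) o\<^sub>L frame_inv \<tau> b"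
proof -
  define X where "X t = b o\<^sub>L (S t - S \<tau>)" for t
  define U where "U = {t \<in> J. norm (X t) < 1}"
  have "continuous_on J S"
    using has_vector_derivative_continuous[OF deriv_S] by (simp add: continuous_at_imp_continuous_on)
  then have "continuous_on J (\<lambda>t. norm (X t))"
    unfolding X_def by (intro continuous_intros
      bounded_bilinear.continuous_on[OF bounded_bilinear_blinfun_compose])
  then have "open ((\<lambda>t. norm (X t)) -` {..<1} \<inter> J)"
    using continuous_on_open_vimage[OF open_J] open_lessThan by blast
  also have "(\<lambda>t. norm (X t)) -` {..<1} \<inter> J = U" by (auto simp: U_def)
  finally have "open U" .
  have "\<exists>Q. Q o\<^sub>L (id_blinfun - X t) = id_blinfun \<and> (id_blinfun - X t) o\<^sub>L Q = id_blinfun"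
    if "t \<in> U" for t
    using that id_minus_invertible[of "X t"] by (auto simp: U_def)
  then obtain Q where Q: "\<And>t. t \<in> U \<Longrightarrow> Q t o\<^sub>L (id_blinfun - X t) = id_blinfun"
      "\<And>t. t \<in> U \<Longrightarrow> (id_blinfun - X t) o\<^sub>L Q t = id_blinfun"
    by metis
  have "\<tau> \<in> U" using \<tau> by (simp add: U_def X_def)
  have "id_blinfun - X \<tau> = id_blinfun" by (simp add: X_def)
  then have Q\<tau>: "Q \<tau> = id_blinfun"
    using Q(1)[OF \<open>\<tau> \<in> U\<close>] by (metis blinfun_apply_blinfun_compose blinfun_apply_id_blinfun blinfun_eqI)
  have ch: "chart \<omega> (\<Gamma> \<tau>) (frame \<tau> b ` D) (\<Gamma> t) = frame \<tau> b o\<^sub>L ((S t - S \<tau>) o\<^sub>L Q t) o\<^sub>L frame_inv \<tau> b"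
    if t: "t \<in> U" for t
  proof -
    let ?c = "frame \<tau> b o\<^sub>L ((S t - S \<tau>) o\<^sub>L Q t) o\<^sub>L frame_inv \<tau> b"
    define E where "E = S t - S \<tau>"
    have tJ: "t \<in> J" using t by (simp add: U_def)
    have E: "E \<in> chart_maps \<omega> A D"
      unfolding E_def by (intro subspace_diff subspace_chart_maps subspaces S tJ \<tau>)
    have Q1: "Q t (x - b (E x)) = x" for x
      using arg_cong[OF Q(1)[OF t], of "\<lambda>f. blinfun_apply f x"]
      by (simp add: X_def E_def[symmetric] blinfun.diff_left)
    have Q2: "Q t x = x + b (E (Q t x))" for x
      using arg_cong[OF Q(2)[OF t], of "\<lambda>f. blinfun_apply f x"]
      by (simp add: X_def E_def[symmetric] blinfun.diff_left algebra_simps)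
    have cf: "frame \<tau> b (v - b (E v)) + ?c (frame \<tau> b (v - b (E v))) = v + S t v" if "v \<in> A" for v
    proof -
      have "frame \<tau> b (v - b (E v)) + ?c (frame \<tau> b (v - b (E v))) = frame \<tau> b (v - b (E v) + E v)"
        by (simp add: frame_inverse Q1 E_def[symmetric] blinfun.add_right)
      also have "\<dots> = v + E v + S \<tau> (v + E v)"
        using that b_simps by (simp add: frame_def blinfun.bilinear_simps)
      also have "\<dots> = v + S t v"
        using S_simps(2)[OF \<tau> chart_maps_in[OF trans E]] S_simps \<tau> tJ
        by (simp add: E_def blinfun.bilinear_simps)
      finally show ?thesis .
    qed
    have "graph_over (\<Gamma> \<tau>) ?c = \<Gamma> t"
    proof (intro equalityI subsetI)
      fix y assume "y \<in> graph_over (\<Gamma> \<tau>) ?c"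
      then obtain a where a: "a \<in> A" "y = frame \<tau> b a + ?c (frame \<tau> b a)"
        by (auto simp: graph_over_image frame_image[symmetric])
      define v where "v = Q t a"
      have v: "v \<in> A" "a = v - b (E v)"
        using Q2[of a] a(1) b_simps(1) subspace_add[OF subspaces(1)] unfolding v_def
        by (metis, metis add_diff_cancel_right')
      then show "y \<in> \<Gamma> t" using cf[OF v(1)] a(2) graph[OF tJ] by (auto simp: graph_over_image)
    next
      fix y assume "y \<in> \<Gamma> t"
      then obtain v where v: "v \<in> A" "y = v + S t v"
        by (auto simp: graph[OF tJ, symmetric] graph_over_image)
      have "v - b (E v) \<in> A" using v b_simps by (intro subspace_diff subspaces)
      then show "y \<in> graph_over (\<Gamma> \<tau>) ?c"
        unfolding v(2) cf[OF v(1), symmetric] graph_over_def frame_image[symmetric] by blast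
    qed
    moreover have "?c \<in> chart_maps \<omega> (\<Gamma> \<tau>) (frame \<tau> b ` D)"
    proof (rule chart_mapsI[OF transverse_frame])
      show "lagrangian \<omega> (graph_over (\<Gamma> \<tau>) ?c)"
        unfolding calculation graph[OF tJ, symmetric]
        using transverse_graph[OF trans S[OF tJ]] by (simp add: transverse_def)
      fix x assume "x \<in> frame \<tau> b ` D"
      then obtain d where d: "d \<in> D" "x = frame \<tau> b d" by blast
      then have "Q t d = d" using Q1[of d] chart_maps_zero[OF E] by (simp add: blinfun.zero_right)
      then show "?c x = 0" using d chart_maps_zero[OF E]
        by (simp add: frame_inverse E_def[symmetric] blinfun.zero_right)
    next
      fix x show "?c x \<in> frame \<tau> b ` D"
        using chart_maps_in[OF trans E] by (simp add: E_def[symmetric])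
    qed
    ultimately show ?thesis by (intro chart_eqI transverse_frame)
  qed
  show ?thesis
    by (rule that[OF \<open>open U\<close> \<open>\<tau> \<in> U\<close> _ Q\<tau> Q[unfolded X_def] ch]) (auto simp: U_def)
qed

text \<open>The frame is constant in \<open>t\<close>, so only \<open>(S t - S \<tau>) Q t\<close>
  is differentiated, using \<open>Q' = Q b S1 Q\<close>. At \<open>\<tau>\<close> the first factor
  vanishes and \<open>Q\<close> is the identity, which removes most terms.\<close>

lemma chart_derivatives:
  defines "c \<equiv> \<lambda>t. chart \<omega> (\<Gamma> \<tau>) (frame \<tau> b ` D) (\<Gamma> t)"
  shows "nth_deriv 1 c \<tau> = frame \<tau> b o\<^sub>L S1 \<tau> o\<^sub>L frame_inv \<tau> b" (is ?d1)
    and "nth_deriv 2 c \<tau> = frame \<tau> b o\<^sub>L (S2 \<tau> + 2 *\<^sub>R (S1 \<tau> o\<^sub>L b o\<^sub>L S1 \<tau>)) o\<^sub>L frame_inv \<tau> b" (is ?d2)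
    and "nth_deriv 3 c \<tau> = frame \<tau> b o\<^sub>L (S3 \<tau> + 3 *\<^sub>R (S1 \<tau> o\<^sub>L b o\<^sub>L S2 \<tau>) + 3 *\<^sub>R (S2 \<tau> o\<^sub>L b o\<^sub>L S1 \<tau>)
       + 6 *\<^sub>R (S1 \<tau> o\<^sub>L b o\<^sub>L S1 \<tau> o\<^sub>L b o\<^sub>L S1 \<tau>)) o\<^sub>L frame_inv \<tau> b" (is ?d3)
proof -
  obtain U Q where U: "open U" "\<tau> \<in> U" "U \<subseteq> J" and Q\<tau>: "Q \<tau> = id_blinfun" and
    Q: "\<And>t. t \<in> U \<Longrightarrow> Q t o\<^sub>L (id_blinfun - (b o\<^sub>L (S t - S \<tau>))) = id_blinfun"
    "\<And>t. t \<in> U \<Longrightarrow> (id_blinfun - (b o\<^sub>L (S t - S \<tau>))) o\<^sub>L Q t = id_blinfun"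
    and ch: "\<And>t. t \<in> U \<Longrightarrow> c t = frame \<tau> b o\<^sub>L ((S t - S \<tau>) o\<^sub>L Q t) o\<^sub>L frame_inv \<tau> b"
    unfolding c_def using chart_near by metis
  note dc = has_vector_derivative_compose_blinfun
  \<comment> \<open>Abbreviating \<open>S1 Q\<close> gives \<open>Q' = Q b P\<close>, so all further
    derivatives are polynomial in quantities whose derivatives are already known.\<close>
  define P where "P t = S1 t o\<^sub>L Q t" for t
  define P1 where "P1 t = (S2 t o\<^sub>L Q t) + (S1 t o\<^sub>L Q t o\<^sub>L b o\<^sub>L P t)" for t
  define P2 where "P2 t = (S3 t o\<^sub>L Q t) + 2 *\<^sub>R (S2 t o\<^sub>L Q t o\<^sub>L b o\<^sub>L P t)
      + (S1 t o\<^sub>L Q t o\<^sub>L b o\<^sub>L P t o\<^sub>L b o\<^sub>L P t) + (S1 t o\<^sub>L Q t o\<^sub>L b o\<^sub>L P1 t)" for t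
  define Y where "Y t = (S t - S \<tau>) o\<^sub>L Q t" for t
  define Y1 where "Y1 t = P t + (Y t o\<^sub>L b o\<^sub>L P t)" for t
  define Y2 where "Y2 t = P1 t + (Y1 t o\<^sub>L b o\<^sub>L P t) + (Y t o\<^sub>L b o\<^sub>L P1 t)" for t
  define Y3 where "Y3 t = P2 t + (Y2 t o\<^sub>L b o\<^sub>L P t) + 2 *\<^sub>R (Y1 t o\<^sub>L b o\<^sub>L P1 t) + (Y t o\<^sub>L b o\<^sub>L P2 t)" for t
  have inJ: "t \<in> J" if "t \<in> U" for t using that U by blast
  have dQ: "(Q has_vector_derivative Q t o\<^sub>L b o\<^sub>L P t) (at t)" if "t \<in> U" for t
  proof -
    have "((\<lambda>t. id_blinfun - (b o\<^sub>L (S t - S \<tau>))) has_vector_derivative - (b o\<^sub>L S1 t)) (at t)"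
      by (rule has_vector_derivative_eq_rhs[OF has_vector_derivative_diff[OF has_vector_derivative_const
            dc[OF has_vector_derivative_const has_vector_derivative_diff[OF deriv_S[OF inJ[OF that]] has_vector_derivative_const]]]])
        (rule blinfun_eqI, simp add: blinfun.bilinear_simps)
    from has_vector_derivative_inverse_blinfun[OF U(1) that Q this] show ?thesis
      by (rule has_vector_derivative_eq_rhs)
        (simp_all, rule blinfun_eqI, simp add: P_def blinfun.bilinear_simps)
  qed
  have dP: "(P has_vector_derivative P1 t) (at t)" if "t \<in> U" for t
    unfolding P_def
    by (rule has_vector_derivative_eq_rhs[OF dc[OF deriv_S1[OF inJ[OF that]] dQ[OF that]]])
      (rule blinfun_eqI, simp add: P_def P1_def blinfun.bilinear_simps)
  have dP1: "(P1 has_vector_derivative P2 t) (at t)" if "t \<in> U" for t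
    unfolding P1_def
    by (rule has_vector_derivative_eq_rhs[OF has_vector_derivative_add[OF dc[OF deriv_S2[OF inJ[OF that]] dQ[OF that]]
          dc[OF dc[OF dc[OF deriv_S1[OF inJ[OF that]] dQ[OF that]] has_vector_derivative_const] dP[OF that]]]])
      (rule blinfun_eqI,
        simp add: P1_def P2_def blinfun.bilinear_simps scaleR_2)
  have dY: "(Y has_vector_derivative Y1 t) (at t)" if "t \<in> U" for t
    unfolding Y_def
    by (rule has_vector_derivative_eq_rhs[OF dc[OF has_vector_derivative_diff[OF deriv_S[OF inJ[OF that]]
          has_vector_derivative_const] dQ[OF that]]])
      (rule blinfun_eqI, simp add: P_def Y_def Y1_def blinfun.bilinear_simps)
  have dY1: "(Y1 has_vector_derivative Y2 t) (at t)" if "t \<in> U" for t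
    unfolding Y1_def
    by (rule has_vector_derivative_eq_rhs[OF has_vector_derivative_add[OF dP[OF that]
          dc[OF dc[OF dY[OF that] has_vector_derivative_const] dP[OF that]]]])
      (rule blinfun_eqI, simp add: Y2_def blinfun.bilinear_simps)
  have dY2: "(Y2 has_vector_derivative Y3 t) (at t)" if "t \<in> U" for t
    unfolding Y2_def
    by (rule has_vector_derivative_eq_rhs[OF has_vector_derivative_add[OF has_vector_derivative_add[OF dP1[OF that]
          dc[OF dc[OF dY1[OF that] has_vector_derivative_const] dP[OF that]]] dc[OF dc[OF dY[OF that] has_vector_derivative_const] dP1[OF that]]]])
      (rule blinfun_eqI, simp add: Y3_def blinfun.bilinear_simps scaleR_2)
  define H where "H X = frame \<tau> b o\<^sub>L X o\<^sub>L frame_inv \<tau> b" for X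
  have "bounded_linear H" unfolding H_def
    by (intro bounded_linear_intros)
  note bl = bounded_linear.has_vector_derivative[OF this]
  have n0: "nth_deriv 0 c t = H (Y t)" if "t \<in> U" for t
    using ch[OF that] by (simp add: H_def Y_def)
  have n1: "nth_deriv (Suc 0) c t = H (Y1 t)" if "t \<in> U" for t
    by (rule nth_deriv_Suc_eqI[OF U(1) that n0 bl[OF dY[OF that]]])
  have n2: "nth_deriv (Suc (Suc 0)) c t = H (Y2 t)" if "t \<in> U" for t
    by (rule nth_deriv_Suc_eqI[OF U(1) that n1 bl[OF dY1[OF that]]])
  have n3: "nth_deriv (Suc (Suc (Suc 0))) c t = H (Y3 t)" if "t \<in> U" for t
    by (rule nth_deriv_Suc_eqI[OF U(1) that n2 bl[OF dY2[OF that]]])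
  have Y: "Y \<tau> = 0" by (simp add: Y_def)
  have P\<tau>: "P \<tau> = S1 \<tau>" by (rule blinfun_eqI) (simp add: P_def Q\<tau>)
  have Y1: "Y1 \<tau> = S1 \<tau>" by (simp add: Y1_def Y P\<tau>)
  have P1\<tau>: "P1 \<tau> = S2 \<tau> + (S1 \<tau> o\<^sub>L b o\<^sub>L S1 \<tau>)"
    by (rule blinfun_eqI) (simp add: P1_def Q\<tau> P\<tau> blinfun.bilinear_simps)
  have Y2: "Y2 \<tau> = S2 \<tau> + 2 *\<^sub>R (S1 \<tau> o\<^sub>L b o\<^sub>L S1 \<tau>)"
    by (simp add: Y2_def Y Y1 P\<tau> P1\<tau> scaleR_2)
  have Y3: "Y3 \<tau> = S3 \<tau> + 3 *\<^sub>R (S1 \<tau> o\<^sub>L b o\<^sub>L S2 \<tau>) + 3 *\<^sub>R (S2 \<tau> o\<^sub>L b o\<^sub>L S1 \<tau>)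
       + 6 *\<^sub>R (S1 \<tau> o\<^sub>L b o\<^sub>L S1 \<tau> o\<^sub>L b o\<^sub>L S1 \<tau>)"
  proof (rule blinfun_eqI)
    fix i
    \<comment> \<open>Integer multiples are expanded into repeated sums, so that both sides agree up
      to reordering.\<close>
    have "(1 + 1 + 1::real) *\<^sub>R x = 3 *\<^sub>R x" "(1 + 1 + 1 + 1::real) *\<^sub>R x = 4 *\<^sub>R x"
      "(1 + 1 + 1 + 1 + 1 + 1::real) *\<^sub>R x = 6 *\<^sub>R x" for x :: 'a
      by simp_all
    note num = this[symmetric, unfolded scaleR_add_left scaleR_one]
    show "Y3 \<tau> i = (S3 \<tau> + 3 *\<^sub>R (S1 \<tau> o\<^sub>L b o\<^sub>L S2 \<tau>) + 3 *\<^sub>R (S2 \<tau> o\<^sub>L b o\<^sub>L S1 \<tau>)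
       + 6 *\<^sub>R (S1 \<tau> o\<^sub>L b o\<^sub>L S1 \<tau> o\<^sub>L b o\<^sub>L S1 \<tau>)) i"
      by (simp add: Y3_def P2_def Y Y1 Y2 P\<tau> P1\<tau> Q\<tau> blinfun.bilinear_simps)
        (simp add: num scaleR_2 algebra_simps)
  qed
  show ?d1 ?d2 ?d3
    using n1[OF U(2)] n2[OF U(2)] n3[OF U(2)] Y1 Y2 Y3
    by (simp_all add: H_def eval_nat_numeral)
qed

end

section \<open>The derivative element and the curvature in terms of \<open>b\<close>\<close>

lemma transverse_eq_frame_image:
  assumes "\<tau> \<in> J" "transverse \<Delta> (\<Gamma> \<tau>)"
  obtains b where "b \<in> chart_maps \<omega> D A" "\<Delta> = frame \<tau> b ` D"
proof -
  have neg: "- S \<tau> \<in> chart_maps \<omega> A D"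
    using subspace_neg[OF subspace_chart_maps[OF subspaces(2)] S[OF assms(1)]] .
  \<comment> \<open>Undoing the shear by \<open>S \<tau>\<close> brings
    \<open>\<Gamma> \<tau>\<close> back to \<open>A\<close>, so \<open>\<Delta>\<close> becomes a
    Lagrangian transverse to \<open>A\<close>, which is a graph over \<open>D\<close>.\<close>
  let ?g = "\<lambda>x. x + (- S \<tau>) x"
  have SS: "S \<tau> (S \<tau> x) = 0" for x
    using chart_maps_square[OF trans S S] assms(1) by blast
  have "?g ` \<Gamma> \<tau> = A"
    unfolding graph[OF assms(1), symmetric] graph_over_image image_image
    by (simp add: SS blinfun.bilinear_simps)
  then have "transverse (?g ` \<Delta>) A"
    using transverse_image[OF assms(2) linear_id_plus_blinfun
        chart_maps_symplectic[OF trans neg]] by simp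
  then obtain b where b: "b \<in> chart_maps \<omega> D A" "graph_over D b = ?g ` \<Delta>"
    using chart_map_exists[OF transverse_sym[OF trans]] by metis
  have "frame \<tau> b ` D = (\<lambda>x. x + S \<tau> x) ` graph_over D b"
    by (simp add: graph_over_image image_image frame_def blinfun.add_left)
  also have "\<dots> = \<Delta>"
    unfolding b(2) image_image by (simp add: SS blinfun.bilinear_simps)
  finally show ?thesis using that b(1) by blast
qed

text \<open>Vanishing of the second derivative prescribes \<open>S1 \<tau> b S1 \<tau>\<close>. As
  \<open>S1 \<tau>\<close> is bijective from \<open>A\<close> onto \<open>D\<close>, this determines
  \<open>b\<close> on \<open>D\<close>, and with it the image \<open>\<Delta>\<close>.\<close>

lemma derivative_element_eqI:
  assumes "\<tau> \<in> J" "\<Delta> \<in> transversals \<omega> (\<Gamma> \<tau>)"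
    and "nth_deriv 2 (\<lambda>t. chart \<omega> (\<Gamma> \<tau>) \<Delta> (\<Gamma> t)) \<tau> = 0"
  shows "derivative_element \<omega> \<Gamma> \<tau> = \<Delta>"
  unfolding derivative_element_def
proof (rule the_equality)
  have lag: "lagrangian \<omega> (\<Gamma> \<tau>)"
    using transverse_graph[OF trans S] graph assms(1) by (auto simp: transverse_def)
  have bS: "\<exists>b\<in>chart_maps \<omega> D A. \<Delta>' = frame \<tau> b ` D \<and> (\<forall>x\<in>A. S1 \<tau> (b (S1 \<tau> x)) = (-1/2) *\<^sub>R S2 \<tau> x)"
    if \<Delta>': "\<Delta>' \<in> transversals \<omega> (\<Gamma> \<tau>)" "nth_deriv 2 (\<lambda>t. chart \<omega> (\<Gamma> \<tau>) \<Delta>' (\<Gamma> t)) \<tau> = 0" for \<Delta>'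
  proof -
    obtain b where b: "b \<in> chart_maps \<omega> D A" "\<Delta>' = frame \<tau> b ` D"
      using transverse_eq_frame_image[OF assms(1)] \<Delta>' transversals_iff[OF lag] by blast
    have 0: "frame \<tau> b o\<^sub>L (S2 \<tau> + 2 *\<^sub>R (S1 \<tau> o\<^sub>L b o\<^sub>L S1 \<tau>)) o\<^sub>L frame_inv \<tau> b = 0"
      using chart_derivatives(2)[OF assms(1) b(1)] \<Delta>'(2) b(2) by simp
    have "S2 \<tau> x + 2 *\<^sub>R S1 \<tau> (b (S1 \<tau> x)) = 0" for x
    proof -
      have "frame \<tau> b (S2 \<tau> x + 2 *\<^sub>R S1 \<tau> (b (S1 \<tau> x))) = 0"
        using arg_cong[OF 0, of "\<lambda>f. blinfun_apply f (frame \<tau> b x)"] frame_inverse[OF assms(1) b(1)]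
        by (simp add: blinfun.add_left blinfun.scaleR_left)
      then show ?thesis
        using frame_inverse(2)[OF assms(1) b(1)] by (metis blinfun.zero_right)
    qed
    then have "2 *\<^sub>R S1 \<tau> (b (S1 \<tau> x)) = - S2 \<tau> x" for x
      by (simp add: eq_neg_iff_add_eq_0 add.commute)
    then have "(1/2) *\<^sub>R (2 *\<^sub>R S1 \<tau> (b (S1 \<tau> x))) = (1/2) *\<^sub>R (- S2 \<tau> x)" for x by simp
    then show ?thesis using b by auto
  qed
  fix \<Delta>' assume \<Delta>': "\<Delta>' \<in> transversals \<omega> (\<Gamma> \<tau>) \<and> nth_deriv 2 (\<lambda>t. chart \<omega> (\<Gamma> \<tau>) \<Delta>' (\<Gamma> t)) \<tau> = 0"
  obtain b where b: "b \<in> chart_maps \<omega> D A" "\<Delta> = frame \<tau> b ` D"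
      "\<forall>x\<in>A. S1 \<tau> (b (S1 \<tau> x)) = (-1/2) *\<^sub>R S2 \<tau> x"
    using bS[OF assms(2,3)] by blast
  obtain b' where b': "b' \<in> chart_maps \<omega> D A" "\<Delta>' = frame \<tau> b' ` D"
      "\<forall>x\<in>A. S1 \<tau> (b' (S1 \<tau> x)) = (-1/2) *\<^sub>R S2 \<tau> x"
    using bS \<Delta>' by blast
  have S1\<tau>: "S1 \<tau> \<in> chart_maps \<omega> A D" by (rule derivatives_chart_maps[OF assms(1)])
  obtain R where R: "\<And>x. x \<in> D \<Longrightarrow> S1 \<tau> (blinfun_apply R x) = x" "R \<in> chart_maps \<omega> D A"
    using chart_map_inverse[OF trans S1\<tau>] regular[OF assms(1)] by metis
  have "b x = b' x" if "x \<in> D" for x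
  proof -
    have "R x \<in> A" using chart_maps_in[OF transverse_sym[OF trans] R(2)] .
    then have "S1 \<tau> (b x) = S1 \<tau> (b' x)" using R(1)[OF that] b(3) b'(3) by metis
    moreover have "b x - b' x \<in> A"
      using chart_maps_in[OF transverse_sym[OF trans]] b(1) b'(1) by (intro subspace_diff subspaces) auto
    ultimately show ?thesis
      using regular[OF assms(1), of "b x - b' x"] by (simp add: blinfun.diff_right)
  qed
  then show "\<Delta>' = \<Delta>" unfolding b(2) b'(2) by (simp add: frame_def blinfun.bilinear_simps)
qed (use assms in simp)

lemma derivative_element_exists:
  assumes "\<tau> \<in> J"
  obtains b where "b \<in> chart_maps \<omega> D A" "derivative_element \<omega> \<Gamma> \<tau> = frame \<tau> b ` D"
    "\<And>x. S2 \<tau> x = - (2 *\<^sub>R S1 \<tau> (b (S1 \<tau> x)))"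
proof -
  have S12: "S1 \<tau> \<in> chart_maps \<omega> A D" "S2 \<tau> \<in> chart_maps \<omega> A D"
    by (rule derivatives_chart_maps[OF assms])+
  have sym: "transverse D A" by (rule transverse_sym[OF trans])
  obtain R where R: "R \<in> chart_maps \<omega> D A" "\<And>x. x \<in> A \<Longrightarrow> R (S1 \<tau> x) = x"
    "\<And>x. x \<in> D \<Longrightarrow> S1 \<tau> (blinfun_apply R x) = x"
    using chart_map_inverse[OF trans S12(1)] regular[OF assms] by metis
  \<comment> \<open>This solves \<open>S2 + 2 S1 b S1 = 0\<close> on \<open>A\<close>, with
    \<open>R\<close> the inverse of \<open>S1 \<tau>\<close>. It is skew because \<open>R\<close>
    and \<open>S2 \<tau>\<close> are.\<close>
  define b where "b = (-1/2) *\<^sub>R (R o\<^sub>L S2 \<tau> o\<^sub>L R)"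
  have "R o\<^sub>L S2 \<tau> o\<^sub>L R \<in> chart_maps \<omega> D A"
  proof -
    have "\<omega> (R (S2 \<tau> (R u))) v + \<omega> u (R (S2 \<tau> (R v))) = 0" for u v
      using chart_maps_skew[OF sym R(1), of "S2 \<tau> (R u)" v] chart_maps_skew[OF sym R(1), of u "S2 \<tau> (R v)"]
        chart_maps_skew[OF trans S12(2), of "R u" "R v"] by simp
    then show ?thesis
      using chart_maps_in[OF sym R(1)] chart_maps_zero[OF R(1)]
      by (simp add: chart_maps_def blinfun.zero_right)
  qed
  then have b: "b \<in> chart_maps \<omega> D A"
    unfolding b_def by (intro subspace_scale subspace_chart_maps subspaces)
  have S2: "S2 \<tau> x = - (2 *\<^sub>R S1 \<tau> (b (S1 \<tau> x)))" for x
  proof -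
    obtain a d where x: "a \<in> A" "d \<in> D" "x = a + d" using transverse_sum[OF trans] .
    then have "S2 \<tau> x = S2 \<tau> a" "S1 \<tau> x = S1 \<tau> a"
      using chart_maps_zero S12 by (simp_all add: blinfun.add_right)
    then show ?thesis
      using R(2)[OF x(1)] R(3)[OF chart_maps_in[OF trans S12(2)], of a]
      by (simp add: b_def blinfun.bilinear_simps)
  qed
  have "nth_deriv 2 (\<lambda>t. chart \<omega> (\<Gamma> \<tau>) (frame \<tau> b ` D) (\<Gamma> t)) \<tau> = 0"
    unfolding chart_derivatives(2)[OF assms b]
    by (rule blinfun_eqI) (simp add: blinfun.bilinear_simps S2)
  moreover have "frame \<tau> b ` D \<in> transversals \<omega> (\<Gamma> \<tau>)"
    using transverse_frame[OF assms b] by (auto simp: transversals_def transverse_def)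
  ultimately show ?thesis using that[OF b derivative_element_eqI[OF assms] S2] by blast
qed

lemma curvature_zero:
  assumes \<tau>: "\<tau> \<in> J" and b: "b \<in> chart_maps \<omega> D A" and "derivative_element \<omega> \<Gamma> \<tau> = frame \<tau> b ` D"
    and S2: "\<And>x. S2 \<tau> x = - (2 *\<^sub>R S1 \<tau> (b (S1 \<tau> x)))"
    and "\<forall>u\<in>\<Gamma> \<tau>. curvature \<omega> \<Gamma> \<tau> u = 0"
  shows "S3 \<tau> x = - (3 *\<^sub>R S2 \<tau> (b (S1 \<tau> x)))"
proof -
  define T where "T = S3 \<tau> + 3 *\<^sub>R (S1 \<tau> o\<^sub>L b o\<^sub>L S2 \<tau>) + 3 *\<^sub>R (S2 \<tau> o\<^sub>L b o\<^sub>L S1 \<tau>)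
       + 6 *\<^sub>R (S1 \<tau> o\<^sub>L b o\<^sub>L S1 \<tau> o\<^sub>L b o\<^sub>L S1 \<tau>)"
  note S123 = derivatives_chart_maps[OF \<tau>]
  let ?c1 = "frame \<tau> b o\<^sub>L S1 \<tau> o\<^sub>L frame_inv \<tau> b" and ?c3 = "frame \<tau> b o\<^sub>L T o\<^sub>L frame_inv \<tau> b"
  have cur: "inv_into (\<Gamma> \<tau>) ?c1 (?c3 u) = 0" if "u \<in> \<Gamma> \<tau>" for u
    using assms(5) that chart_derivatives[OF \<tau> b] unfolding curvature_def assms(3) T_def[symmetric]
    by (simp add: Let_def)
  have TD: "T y \<in> D" for y
    unfolding T_def using chart_maps_in[OF trans] S123 subspaces
    by (simp add: blinfun.bilinear_simps subspace_add subspace_scale)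
  obtain R where R: "R \<in> chart_maps \<omega> D A" "\<And>x. x \<in> A \<Longrightarrow> R (S1 \<tau> x) = x"
    "\<And>x. x \<in> D \<Longrightarrow> S1 \<tau> (blinfun_apply R x) = x"
    using chart_map_inverse[OF trans S123(1)] regular[OF \<tau>] by metis
  have TA: "T a = 0" if "a \<in> A" for a
  proof -
    \<comment> \<open>\<open>inv_into\<close> is a genuine inverse only on the image, so the value
      of \<open>?c3\<close> is first exhibited as a value of \<open>?c1\<close>; only then does zero
      curvature force it to vanish.\<close>
    have "?c3 (frame \<tau> b a) = ?c1 (frame \<tau> b (R (T a)))"
      using R(3)[OF TD] by (simp add: frame_inverse[OF \<tau> b])
    moreover have "frame \<tau> b (R (T a)) \<in> \<Gamma> \<tau>"
      using chart_maps_in[OF transverse_sym[OF trans] R(1)] frame_image[OF \<tau> b] by blast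
    ultimately have "?c3 (frame \<tau> b a) \<in> ?c1 ` \<Gamma> \<tau>" by blast
    then have "?c1 (inv_into (\<Gamma> \<tau>) ?c1 (?c3 (frame \<tau> b a))) = ?c3 (frame \<tau> b a)"
      by (rule f_inv_into_f)
    moreover have "inv_into (\<Gamma> \<tau>) ?c1 (?c3 (frame \<tau> b a)) = 0"
      using that frame_image[OF \<tau> b] by (intro cur) blast
    ultimately have "?c3 (frame \<tau> b a) = 0" by (simp only: blinfun.zero_right)
    then show ?thesis
      using frame_inverse[OF \<tau> b] by (metis blinfun.zero_right blinfun_apply_blinfun_compose)
  qed
  obtain a d where x: "a \<in> A" "d \<in> D" "x = a + d" using transverse_sum[OF trans] .
  then have eq: "S3 \<tau> x = S3 \<tau> a" "S1 \<tau> x = S1 \<tau> a"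
    using chart_maps_zero S123 by (simp_all add: blinfun.add_right)
  \<comment> \<open>By the formula for \<open>S2\<close> the two mixed terms of \<open>T\<close>
    contribute \<open>-6 z\<close> each and the last one \<open>6 z\<close>, leaving
    \<open>S3 = 6 z\<close>.\<close>
  define z where "z = S1 \<tau> (b (S1 \<tau> (b (S1 \<tau> a))))"
  have "S3 \<tau> a - 6 *\<^sub>R z - 6 *\<^sub>R z + 6 *\<^sub>R z = 0"
    using TA[OF x(1)] by (simp add: T_def blinfun.bilinear_simps S2 z_def)
  then have "S3 \<tau> a = 6 *\<^sub>R z" by (simp add: algebra_simps)
  then show ?thesis unfolding eq by (simp add: S2 z_def)
qed

end

section \<open>Vanishing curvature\<close>

context jacobi_chart
begin

text \<open>After the linear fractional form of \<open>S\<close> is established, the frame at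
  \<open>t0\<close> built from \<open>b t0\<close> absorbs its denominator: in the new chart the
  curve is \<open>(t - t0) B\<close>, with \<open>B\<close> the conjugate of
  \<open>S1 t0\<close>.\<close>

lemma straight_near:
  assumes t0: "t0 \<in> J" and flat: "\<And>t u. t \<in> J \<Longrightarrow> u \<in> \<Gamma> t \<Longrightarrow> curvature \<omega> \<Gamma> t u = 0"
  obtains e B where "e > 0" "transverse (\<Gamma> t0) (derivative_element \<omega> \<Gamma> t0)"
    "B \<in> chart_maps \<omega> (\<Gamma> t0) (derivative_element \<omega> \<Gamma> t0)"
    "\<And>x. x \<in> \<Gamma> t0 \<Longrightarrow> blinfun_apply B x = 0 \<Longrightarrow> x = 0"
    "\<And>t. \<bar>t - t0\<bar> < e \<Longrightarrow> t \<in> J" "\<And>t. \<bar>t - t0\<bar> < e \<Longrightarrow> graph_over (\<Gamma> t0) ((t - t0) *\<^sub>R B) = \<Gamma> t"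
proof -
  have "\<exists>b. b \<in> chart_maps \<omega> D A \<and> derivative_element \<omega> \<Gamma> t = frame t b ` D \<and>
      (\<forall>x. S2 t x = - (2 *\<^sub>R S1 t (b (S1 t x)))) \<and> (\<forall>x. S3 t x = - (3 *\<^sub>R S2 t (b (S1 t x))))"
    if t: "t \<in> J" for t
  proof -
    obtain b where b: "b \<in> chart_maps \<omega> D A" "derivative_element \<omega> \<Gamma> t = frame t b ` D"
        "\<And>x. S2 t x = - (2 *\<^sub>R S1 t (b (S1 t x)))"
      using derivative_element_exists[OF t] by blast
    then show ?thesis using curvature_zero[OF t b] flat[OF t] by blast
  qed
  then obtain b where b: "\<And>t. t \<in> J \<Longrightarrow> b t \<in> chart_maps \<omega> D A"
      "\<And>t. t \<in> J \<Longrightarrow> derivative_element \<omega> \<Gamma> t = frame t (b t) ` D"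
      "\<And>t x. t \<in> J \<Longrightarrow> S2 t x = - (2 *\<^sub>R S1 t (b t (S1 t x)))"
      "\<And>t x. t \<in> J \<Longrightarrow> S3 t x = - (3 *\<^sub>R S2 t (b t (S1 t x)))"
    by metis
  define k where "k t = b t o\<^sub>L S1 t" for t
  define K where "K = k t0"
  have kA: "k t x \<in> A" if "t \<in> J" for t x
    using chart_maps_in[OF transverse_sym[OF trans] b(1)[OF that]] by (simp add: k_def)
  have S2k: "S2 t x = - (2 *\<^sub>R S1 t (k t x))" and S3k: "S3 t x = - (3 *\<^sub>R S2 t (k t x))"
    if "t \<in> J" for t x
    using b(3,4)[OF that] by (simp_all add: k_def)
  obtain e1 where e1: "e1 > 0" "\<And>t. \<bar>t - t0\<bar> < e1 \<Longrightarrow> t \<in> J"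
  proof -
    obtain r where "r > 0" "ball t0 r \<subseteq> J" using openE[OF open_J t0] by blast
    then show ?thesis using that[of r] by (simp add: dist_real_def abs_minus_commute subset_iff)
  qed
  obtain R where R: "\<And>x. x \<in> A \<Longrightarrow> blinfun_apply R (S1 t0 x) = x"
    using chart_map_inverse[OF trans derivatives_chart_maps(1)[OF t0]] regular[OF t0] by metis
  have "(S1 \<longlongrightarrow> S1 t0) (at t0)" "(S2 \<longlongrightarrow> S2 t0) (at t0)"
    using has_vector_derivative_continuous[OF deriv_S1[OF t0]]
      has_vector_derivative_continuous[OF deriv_S2[OF t0]] by (simp_all add: continuous_within)
  then have "\<forall>\<^sub>F t in at t0. norm (R o\<^sub>L (S1 t - S1 t0)) < 1/2 \<and> norm (S2 t) < norm (S2 t0) + 1"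
  proof (intro eventually_conj)
    assume "(S1 \<longlongrightarrow> S1 t0) (at t0)"
    then have "((\<lambda>t. norm (R o\<^sub>L (S1 t - S1 t0))) \<longlongrightarrow> norm (R o\<^sub>L (S1 t0 - S1 t0))) (at t0)"
      by (intro tendsto_intros bounded_bilinear.tendsto[OF bounded_bilinear_blinfun_compose])
    then show "\<forall>\<^sub>F t in at t0. norm (R o\<^sub>L (S1 t - S1 t0)) < 1/2"
      by (intro order_tendstoD) auto
  next
    assume "(S2 \<longlongrightarrow> S2 t0) (at t0)"
    then have "((\<lambda>t. norm (S2 t)) \<longlongrightarrow> norm (S2 t0)) (at t0)" by (rule tendsto_norm)
    then show "\<forall>\<^sub>F t in at t0. norm (S2 t) < norm (S2 t0) + 1"
      by (intro order_tendstoD) auto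
  qed
  then obtain e2 where e2: "e2 > 0"
      "\<And>t. t \<noteq> t0 \<Longrightarrow> \<bar>t - t0\<bar> < e2 \<Longrightarrow> norm (R o\<^sub>L (S1 t - S1 t0)) < 1/2 \<and> norm (S2 t) < norm (S2 t0) + 1"
    unfolding eventually_at by (auto simp: dist_real_def)
  define e where "e = min e1 e2"
  have e: "e > 0" "\<And>t. \<bar>t - t0\<bar> < e \<Longrightarrow> t \<in> J" using e1 e2(1) by (auto simp: e_def)
  \<comment> \<open>On \<open>A\<close>, \<open>R\<close> undoes \<open>S1 t0\<close>, and the
    perturbation \<open>R (S1 t - S1 t0)\<close> has norm at most \<open>1/2\<close>; absorbing it
    yields the factor \<open>2\<close>, uniformly in \<open>t\<close>.\<close>
  have S1_lower: "norm x \<le> 2 * norm R * norm (S1 t x)" if "\<bar>t - t0\<bar> < e" "x \<in> A" for t x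
  proof -
    have "norm (R o\<^sub>L (S1 t - S1 t0)) \<le> 1/2"
      using e2(2)[of t] that(1) by (cases "t = t0") (auto simp: e_def)
    then have "norm ((R o\<^sub>L (S1 t - S1 t0)) x) \<le> 1/2 * norm x"
      by (meson mult_right_mono norm_blinfun norm_ge_zero order_trans)
    moreover have "(R o\<^sub>L (S1 t - S1 t0)) x = R (S1 t x) - x"
      using R[OF that(2)] by (simp add: blinfun.bilinear_simps)
    ultimately have "norm x \<le> norm (R (S1 t x)) + 1/2 * norm x"
      using norm_triangle_sub[of x "R (S1 t x)"] by (simp add: norm_minus_commute)
    then show ?thesis using norm_blinfun[of R "S1 t x"] by simp
  qed
  have S2_bound: "norm (S2 t) \<le> norm (S2 t0) + 1" if "\<bar>t - t0\<bar> < e" for t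
    using e2(2)[of t] that by (cases "t = t0") (auto simp: e_def)
  note dc = has_vector_derivative_compose_blinfun
  have dK: "((\<lambda>t. id_blinfun + (t - t0) *\<^sub>R K) has_vector_derivative K) (at t)" for t
    by (auto intro!: derivative_eq_intros)
  \<comment> \<open>\<open>Z0 = 0\<close> says \<open>S t = S t0 + h *\<^sub>R (S1 t0 o\<^sub>L (id_blinfun + h *\<^sub>R K)\<^sup>-\<^sup>1)\<close> with \<open>h = t - t0\<close>, the linear
    fractional solution of the Schwarzian equation; \<open>Z1\<close>, \<open>Z2\<close>, \<open>Z3\<close> are the derivatives of \<open>Z0\<close>.\<close>
  define Z0 where "Z0 t = ((S t - S t0) o\<^sub>L (id_blinfun + (t - t0) *\<^sub>R K)) - (t - t0) *\<^sub>R S1 t0" for t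
  define Z1 where "Z1 t = (S1 t o\<^sub>L (id_blinfun + (t - t0) *\<^sub>R K)) + ((S t - S t0) o\<^sub>L K) - S1 t0" for t
  define Z2 where "Z2 t = (S2 t o\<^sub>L (id_blinfun + (t - t0) *\<^sub>R K)) + 2 *\<^sub>R (S1 t o\<^sub>L K)" for t
  define Z3 where "Z3 t = (S3 t o\<^sub>L (id_blinfun + (t - t0) *\<^sub>R K)) + (S2 t o\<^sub>L K) + 2 *\<^sub>R (S2 t o\<^sub>L K)" for t
  have dZ0: "(Z0 has_vector_derivative Z1 t) (at t)" if "t \<in> J" for t
  proof -
    have "((\<lambda>t. S t - S t0) has_vector_derivative S1 t) (at t)"
      using has_vector_derivative_diff[OF deriv_S[OF that] has_vector_derivative_const] by simp
    moreover have "((\<lambda>t. (t - t0) *\<^sub>R S1 t0) has_vector_derivative S1 t0) (at t)"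
      by (auto intro!: derivative_eq_intros)
    ultimately show ?thesis
      unfolding Z0_def
      by (intro has_vector_derivative_eq_rhs[OF has_vector_derivative_diff[OF dc[OF _ dK]]])
        (auto simp: Z1_def)
  qed
  have dZ1: "(Z1 has_vector_derivative Z2 t) (at t)" if "t \<in> J" for t
  proof -
    have "((\<lambda>t. S t - S t0) has_vector_derivative S1 t) (at t)"
      using has_vector_derivative_diff[OF deriv_S[OF that] has_vector_derivative_const] by simp
    from has_vector_derivative_diff[OF has_vector_derivative_add[OF dc[OF deriv_S1[OF that] dK]
        dc[OF this has_vector_derivative_const]] has_vector_derivative_const]
    show ?thesis unfolding Z1_def Z2_def
      by (rule has_vector_derivative_eq_rhs) (simp add: scaleR_2)
  qed
  have dZ2: "(Z2 has_vector_derivative Z3 t) (at t)" if "t \<in> J" for t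
  proof -
    have "((\<lambda>t. 2 *\<^sub>R (S1 t o\<^sub>L K)) has_vector_derivative 2 *\<^sub>R (S2 t o\<^sub>L K)) (at t)"
      using bounded_linear.has_vector_derivative[OF bounded_linear_scaleR_right
          dc[OF deriv_S1[OF that] has_vector_derivative_const]] by simp
    from has_vector_derivative_add[OF dc[OF deriv_S2[OF that] dK] this]
    show ?thesis unfolding Z2_def Z3_def
      by (rule has_vector_derivative_eq_rhs) (simp add: add.commute)
  qed
  \<comment> \<open>The factor \<open>3\<close> comes from \<open>Z3 = -3 S2 z\<close>, the sum
    bounds \<open>S2\<close>, and \<open>norm R\<close> comes from the lower bound for
    \<open>S1\<close>, whose factor \<open>2\<close> is used up by
    \<open>Z2 = -2 S1 z\<close>.\<close>
  define C where "C = 3 * norm R * (norm (S2 t0) + 1)"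
  have "norm (Z3 t) \<le> C * norm (Z2 t)" if t: "\<bar>t - t0\<bar> < e" for t
  proof (rule norm_blinfun_bound)
    show "0 \<le> C * norm (Z2 t)" by (simp add: C_def)
    fix x
    define y where "y = x + (t - t0) *\<^sub>R K x"
    \<comment> \<open>Both \<open>Z2 t x\<close> and \<open>Z3 t x\<close> depend on
      \<open>k t\<close> only through this vector of \<open>A\<close>, which closes the differential
      inequality without a derivative of \<open>k\<close>.\<close>
    define z where "z = k t y - K x"
    have tJ: "t \<in> J" using e t by blast
    have zA: "z \<in> A" unfolding z_def K_def using kA tJ t0 by (intro subspace_diff subspaces)
    have "Z2 t x = S2 t y + 2 *\<^sub>R S1 t (K x)"
      by (simp add: Z2_def y_def blinfun.add_left blinfun.scaleR_left)
    then have Z2z: "Z2 t x = - (2 *\<^sub>R S1 t z)"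
      by (simp add: z_def S2k[OF tJ, of y] blinfun.diff_right scaleR_diff_right)
    have "Z3 t x = S3 t y + (1 + 2) *\<^sub>R S2 t (K x)"
      unfolding scaleR_add_left by (simp add: Z3_def y_def blinfun.add_left blinfun.scaleR_left)
    then have Z3z: "Z3 t x = - (3 *\<^sub>R S2 t z)"
      by (simp add: z_def S3k[OF tJ, of y] blinfun.diff_right scaleR_diff_right)
    have "norm (Z3 t x) \<le> 3 * (norm (S2 t) * norm z)"
      unfolding Z3z using norm_blinfun[of "S2 t" z] by simp
    also have "\<dots> \<le> 3 * ((norm (S2 t0) + 1) * (2 * norm R * norm (S1 t z)))"
      by (intro mult_left_mono mult_mono S2_bound[OF t] S1_lower[OF t zA]) auto
    also have "\<dots> = C * norm (Z2 t x)"
      unfolding Z2z C_def by simp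
    also have "\<dots> \<le> C * (norm (Z2 t) * norm x)"
      by (intro mult_left_mono norm_blinfun) (simp add: C_def)
    finally show "norm (Z3 t x) \<le> C * norm (Z2 t) * norm x" by (simp add: mult.assoc)
  qed
  moreover have "Z2 t0 = 0"
    by (rule blinfun_eqI) (simp add: Z2_def blinfun.bilinear_simps S2k[OF t0] K_def)
  ultimately obtain d2 where d2: "0 < d2" "d2 \<le> e" "\<And>t. \<bar>t - t0\<bar> < d2 \<Longrightarrow> Z2 t = 0"
    using linear_growth_bound_zero[OF e(1) dZ2[OF e(2)]] by blast
  have Z1_0: "Z1 t0 = 0"
    by (rule blinfun_eqI) (simp add: Z1_def blinfun.bilinear_simps)
  \<comment> \<open>The growth constant \<open>0\<close> integrates the vanishing
    derivative.\<close>
  have "norm (Z2 t) \<le> 0 * norm (Z1 t)" "t \<in> J" if "\<bar>t - t0\<bar> < d2" for t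
    using d2(3)[OF that] e(2)[of t] that d2(2) by auto
  then obtain d1 where d1: "0 < d1" "d1 \<le> d2" "\<And>t. \<bar>t - t0\<bar> < d1 \<Longrightarrow> Z1 t = 0"
    using linear_growth_bound_zero[OF d2(1) dZ1 _ Z1_0, of 0] by blast
  have Z0_0: "Z0 t0 = 0" by (simp add: Z0_def)
  have "norm (Z1 t) \<le> 0 * norm (Z0 t)" "t \<in> J" if "\<bar>t - t0\<bar> < d1" for t
    using d1(3)[OF that] e(2)[of t] that d1(2) d2(2) by auto
  then obtain d0 where d0: "0 < d0" "d0 \<le> d1" "\<And>t. \<bar>t - t0\<bar> < d0 \<Longrightarrow> Z0 t = 0"
    using linear_growth_bound_zero[OF d1(1) dZ0 _ Z0_0, of 0] by blast
  \<comment> \<open>The second bound makes \<open>1 + (t - t0) K\<close> invertible, so that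
    \<open>p + (t - t0) K p\<close> runs through all of \<open>A\<close>.\<close>
  define d where "d = min d0 (1 / (norm K + 1))"
  have "d > 0" using d0 by (simp add: d_def add_nonneg_pos)
  define F where "F = frame t0 (b t0)"
  define B where "B = F o\<^sub>L S1 t0 o\<^sub>L frame_inv t0 (b t0)"
  note bt0 = b(1)[OF t0]
  have F_image: "F ` A = \<Gamma> t0" unfolding F_def by (rule frame_image[OF t0 bt0])
  have BF: "B (F x) = F (S1 t0 x)" for x
    by (simp add: B_def F_def frame_inverse[OF t0 bt0])
  have dJ: "t \<in> J" if "\<bar>t - t0\<bar> < d" for t
    using that d0 d1 d2 e by (auto simp: d_def)
  have "graph_over (\<Gamma> t0) ((t - t0) *\<^sub>R B) = \<Gamma> t" if t: "\<bar>t - t0\<bar> < d" for t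
  proof -
    define h where "h = t - t0"
    have tJ: "t \<in> J" using dJ[OF t] .
    \<comment> \<open>Indexing \<open>\<Gamma> t\<close> by base vectors \<open>p + h K p\<close>
      clears the denominator. The term \<open>h K p\<close> is produced by the frame itself, since
      \<open>K = b t0 S1 t0\<close>.\<close>
    have main: "F p + h *\<^sub>R B (F p) = (p + h *\<^sub>R K p) + S t (p + h *\<^sub>R K p)" if "p \<in> A" for p
    proof -
      have "Z0 t p = 0" using d0(3)[of t] t by (simp add: d_def)
      then have "S t (p + h *\<^sub>R K p) = S t0 (p + h *\<^sub>R K p) + h *\<^sub>R S1 t0 p"
        by (simp add: Z0_def h_def blinfun.bilinear_simps algebra_simps)
      moreover have "F p = p + S t0 p"
        using chart_maps_zero[OF bt0 that] by (simp add: F_def frame_def blinfun.bilinear_simps)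
      moreover have "F (S1 t0 p) = S1 t0 p + K p + S t0 (K p)"
        using chart_maps_square[OF trans S[OF t0] derivatives_chart_maps(1)[OF t0]]
        by (simp add: F_def frame_def K_def k_def blinfun.bilinear_simps)
      ultimately show ?thesis
        unfolding BF by (simp add: blinfun.bilinear_simps scaleR_add_right)
    qed
    have "norm (- (h *\<^sub>R K)) < 1"
    proof -
      have "\<bar>h\<bar> * (norm K + 1) < 1" using t by (simp add: d_def h_def less_divide_eq add_nonneg_pos)
      then show ?thesis using mult_left_mono[of "norm K" "norm K + 1" "\<bar>h\<bar>"] by simp
    qed
    then obtain Q where Q: "(id_blinfun - (- (h *\<^sub>R K))) o\<^sub>L Q = id_blinfun"
      using id_minus_invertible by blast
    have Qp: "Q v + h *\<^sub>R K (Q v) = v" for v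
      using arg_cong[OF Q, of "\<lambda>f. blinfun_apply f v"] by (simp add: blinfun.bilinear_simps)
    have KA: "K x \<in> A" for x unfolding K_def by (rule kA[OF t0])
    show ?thesis
      unfolding F_image[symmetric] graph[OF tJ, symmetric] graph_over_image image_image
        h_def[symmetric] blinfun.scaleR_left
    proof (intro equalityI subsetI)
      fix y assume "y \<in> (\<lambda>p. F p + h *\<^sub>R B (F p)) ` A"
      then obtain p where p: "p \<in> A" "y = F p + h *\<^sub>R B (F p)" by blast
      then show "y \<in> (\<lambda>u. u + S t u) ` A"
        using main[OF p(1)] KA by (auto intro!: imageI subspace_add subspace_scale subspaces)
    next
      fix y assume "y \<in> (\<lambda>u. u + S t u) ` A"
      then obtain v where v: "v \<in> A" "y = v + S t v" by blast
      have "Q v = v - h *\<^sub>R K (Q v)" using Qp[of v] by (simp add: algebra_simps)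
      also have "\<dots> \<in> A" using v KA by (intro subspace_diff subspace_scale subspaces)
      finally have QA: "Q v \<in> A" .
      have "y = F (Q v) + h *\<^sub>R B (F (Q v))" using main[OF QA] Qp[of v] v(2) by simp
      then show "y \<in> (\<lambda>p. F p + h *\<^sub>R B (F p)) ` A" using QA by blast
    qed
  qed
  moreover have "B \<in> chart_maps \<omega> (\<Gamma> t0) (derivative_element \<omega> \<Gamma> t0)"
    unfolding b(2)[OF t0] B_def F_def
    by (rule conjugate_chart_maps[OF t0 bt0 derivatives_chart_maps(1)[OF t0]])
  moreover have "transverse (\<Gamma> t0) (derivative_element \<omega> \<Gamma> t0)"
    unfolding b(2)[OF t0] by (rule transverse_frame[OF t0 bt0])
  moreover have "x = 0" if x: "x \<in> \<Gamma> t0" "B x = 0" for x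
  proof -
    obtain a where a: "a \<in> A" "x = F a" using x F_image by blast
    then have "F (S1 t0 a) = 0" using x BF by simp
    then have "S1 t0 a = 0"
      using frame_inverse(2)[OF t0 bt0, of "S1 t0 a"] by (simp add: F_def blinfun.zero_right)
    then show ?thesis using regular[OF t0 a(1)] a by (simp add: blinfun.zero_right)
  qed
  ultimately show ?thesis using that[OF \<open>d > 0\<close>] dJ by blast
qed

end

section \<open>From Jacobi curves to charts\<close>

context symplectic
begin

text \<open>The curve with constant base vector \<open>u\<close> realizes the value. For another
  \<open>v\<close>, the motion of the base vector adds to \<open>v'\<close> a vector of
  \<open>\<Gamma> t0\<close>, which pairs to zero with \<open>v t0\<close> because
  \<open>\<Gamma> t0\<close> is isotropic.\<close>

lemma velocity_form_chart:
  assumes tr: "transverse A D" and "open J" "t0 \<in> J" and smooth: "smooth_on J S"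
    and S: "\<And>t. t \<in> J \<Longrightarrow> S t \<in> chart_maps \<omega> A D"
    and gr: "\<And>t. t \<in> J \<Longrightarrow> graph_over A (S t) = \<Gamma> t" and "u \<in> A"
  shows "velocity_form \<omega> \<Gamma> t0 (u + blinfun_apply (S t0) u) = \<omega> u (nth_deriv 1 S t0 u)"
  unfolding velocity_form_def
proof (rule the_equality)
  have dS: "(S has_vector_derivative nth_deriv 1 S t0) (at t0)"
    using smooth_on_has_vector_derivative[OF smooth assms(3), of 0] by simp
  have sub: "subspace A" "subspace D" using tr by (auto simp: transverse_def lagrangian_def)
  have S1: "nth_deriv 1 S t0 \<in> chart_maps \<omega> A D"
    by (rule has_vector_derivative_in_closed_subspace[OF subspace_chart_maps[OF sub(2)]
          closed_chart_maps[OF sub(2)] assms(2,3) S dS])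
  have iso: "\<omega> x y = 0" if "x \<in> D" "y \<in> D" for x y
    using tr that lagrangian_isotropic by (auto simp: transverse_def)
  have q: "\<omega> (u + S t0 u) (nth_deriv 1 S t0 u) = \<omega> u (nth_deriv 1 S t0 u)"
    using iso[OF chart_maps_in[OF tr S[OF assms(3)]] chart_maps_in[OF tr S1]]
    by (simp add: omega_simps)
  show "\<exists>J v. open J \<and> t0 \<in> J \<and> smooth_on J v \<and> (\<forall>t\<in>J. v t \<in> \<Gamma> t) \<and> v t0 = u + S t0 u \<and>
      \<omega> u (nth_deriv 1 S t0 u) = \<omega> (u + S t0 u) (vector_derivative v (at t0))"
  proof (intro exI[of _ J] exI[of _ "\<lambda>t. u + S t u"] conjI)
    show "smooth_on J (\<lambda>t. u + S t u)"
      by (rule smooth_on_add_const[OF assms(2)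
            smooth_on_bounded_linear[OF blinfun.bounded_linear_left assms(2) smooth]])
    show "\<forall>t\<in>J. u + S t u \<in> \<Gamma> t" using gr assms(7) by (auto simp: graph_over_def)
    have "((\<lambda>t. u + S t u) has_vector_derivative 0 + nth_deriv 1 S t0 u) (at t0)"
      by (rule has_vector_derivative_add[OF has_vector_derivative_const
            bounded_linear.has_vector_derivative[OF blinfun.bounded_linear_left dS]])
    then show "\<omega> u (nth_deriv 1 S t0 u) = \<omega> (u + S t0 u) (vector_derivative (\<lambda>t. u + S t u) (at t0))"
      using q by (simp add: vector_derivative_at)
  qed (use assms in auto)
  fix q assume "\<exists>J v. open J \<and> t0 \<in> J \<and> smooth_on J v \<and> (\<forall>t\<in>J. v t \<in> \<Gamma> t) \<and> v t0 = u + S t0 u \<and>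
      q = \<omega> (u + S t0 u) (vector_derivative v (at t0))"
  then obtain J' v where v: "open J'" "t0 \<in> J'" "smooth_on J' v" "\<And>t. t \<in> J' \<Longrightarrow> v t \<in> \<Gamma> t"
    "v t0 = u + S t0 u" "q = \<omega> (u + S t0 u) (vector_derivative v (at t0))" by blast
  obtain p :: "'a \<Rightarrow>\<^sub>L 'a" where p: "\<And>x. p x \<in> A" "\<And>x. x \<in> A \<Longrightarrow> p x = x" "\<And>x. x \<in> D \<Longrightarrow> p x = 0"
    using transverse_projection[OF tr] by metis
  \<comment> \<open>The base vector of \<open>v t\<close> is its projection \<open>p (v t)\<close>
    along \<open>D\<close>, so it is differentiable because \<open>v\<close> is.\<close>
  have v_eq: "v t = p (v t) + S t (p (v t))" if t: "t \<in> J \<inter> J'" for t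
  proof -
    obtain a where a: "a \<in> A" "v t = a + S t a"
      using v(4)[of t] gr[of t] t by (auto simp: graph_over_def)
    then have "p (v t) = a"
      using p chart_maps_in[OF tr S] t by (simp add: blinfun.add_right)
    then show ?thesis using a by simp
  qed
  define v' where "v' = vector_derivative v (at t0)"
  have dv: "(v has_vector_derivative v') (at t0)"
    using v(2,3) smooth_on_has_vector_derivative[of J' v t0 0] by (simp add: v'_def nth_deriv_Suc)
  have dp: "((\<lambda>t. p (v t)) has_vector_derivative p v') (at t0)"
    by (rule bounded_linear.has_vector_derivative[OF blinfun.bounded_linear_right dv])
  have pv: "p (v t0) = u"
    using p assms(7) chart_maps_in[OF tr S[OF assms(3)]] by (simp add: v(5) blinfun.add_right)
  have "((\<lambda>t. p (v t) + S t (p (v t))) has_vector_derivative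
      p v' + (S t0 (p v') + nth_deriv 1 S t0 u)) (at t0)"
    using has_vector_derivative_add[OF dp
        bounded_bilinear.has_vector_derivative[OF bounded_bilinear_blinfun_apply dS dp]]
    by (simp add: pv)
  then have "(v has_vector_derivative p v' + (S t0 (p v') + nth_deriv 1 S t0 u)) (at t0)"
    by (rule has_vector_derivative_transform_within_open[of _ _ _ "J \<inter> J'"])
      (use assms(2,3) v(1,2) v_eq in \<open>auto simp del: Int_iff\<close>)
  then have "v' = p v' + (S t0 (p v') + nth_deriv 1 S t0 u)"
    using dv vector_derivative_unique_at by blast
  then have "q = \<omega> (u + S t0 u) ((p v' + S t0 (p v')) + nth_deriv 1 S t0 u)"
    using v(6) by (simp add: v'_def add.assoc)
  also have "\<dots> = \<omega> u (p v') + \<omega> u (nth_deriv 1 S t0 u)"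
    unfolding bilinear_radd[OF bilinear, of _ "p v' + S t0 (p v')"] q chart_maps_symplectic[OF tr S[OF assms(3)]] ..
  also have "\<omega> u (p v') = 0"
    using lagrangian_isotropic[of A] tr assms(7) p(1) by (simp add: transverse_def)
  finally show "q = \<omega> u (nth_deriv 1 S t0 u)" by simp
qed

text \<open>The point is \<open>regular\<close>: if the chart velocity kills \<open>x\<close> in
  \<open>A\<close>, skewness makes the polar form vanish between \<open>x + S t x\<close> and all of
  \<open>\<Gamma> t\<close>, so \<open>x = - S t x\<close> lies in both \<open>A\<close> and
  \<open>D\<close>.\<close>

lemma jacobi_chart_exists:
  assumes "jacobi_curve \<omega> I \<Gamma>" "t0 \<in> I"
  obtains A D J S S1 S2 S3 where "t0 \<in> J" "J \<subseteq> I" "jacobi_chart \<omega> A D J \<Gamma> S S1 S2 S3"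
proof -
  obtain J D A where J: "open J" "t0 \<in> J" "J \<subseteq> I" "lagrangian \<omega> D"
      "\<forall>t\<in>J. \<Gamma> t \<in> transversals \<omega> D" "A \<in> transversals \<omega> D"
      "smooth_on J (\<lambda>t. chart \<omega> A D (\<Gamma> t))"
    using assms unfolding jacobi_curve_def smooth_lagrangian_curve_def by blast
  define S where "S t = chart \<omega> A D (\<Gamma> t)" for t
  have tr: "transverse A D" "\<And>t. t \<in> J \<Longrightarrow> transverse (\<Gamma> t) D"
    using J(4-6) transversals_iff by auto
  have S: "S t \<in> chart_maps \<omega> A D" "graph_over A (S t) = \<Gamma> t" if "t \<in> J" for t
    unfolding S_def using chart_works[OF tr(1) tr(2)[OF that]] by auto
  have smooth: "smooth_on J S" using J(7) by (simp add: S_def[abs_def])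
  have sub: "subspace A" "subspace D" using tr(1) by (auto simp: transverse_def lagrangian_def)
  have dS: "(S has_vector_derivative nth_deriv 1 S t) (at t)" if "t \<in> J" for t
    using smooth_on_has_vector_derivative[OF smooth that, of 0] by simp
  have "x = 0" if t: "t \<in> J" and x: "x \<in> A" "nth_deriv 1 S t x = 0" for t x
  proof -
    note vf = velocity_form_chart[OF tr(1) J(1) t smooth S]
    let ?q = "velocity_form \<omega> \<Gamma> t"
    have S1: "nth_deriv 1 S t \<in> chart_maps \<omega> A D"
      by (rule has_vector_derivative_in_closed_subspace[OF subspace_chart_maps[OF sub(2)]
            closed_chart_maps[OF sub(2)] J(1) t S(1) dS[OF t]])
    have "nondegenerate_quadratic_on (\<Gamma> t) ?q"
      using assms(1) t J(3) by (auto simp: jacobi_curve_def)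
    moreover have "x + S t x \<in> \<Gamma> t"
      unfolding S(2)[OF t, symmetric] graph_over_def using x by blast
    moreover have "?q ((x + S t x) + v) - ?q (x + S t x) - ?q v = 0" if v: "v \<in> \<Gamma> t" for v
    proof -
      obtain a where a: "a \<in> A" "v = a + S t a"
        using v unfolding S(2)[OF t, symmetric] graph_over_def by blast
      have "(x + S t x) + v = (x + a) + S t (x + a)"
        by (simp add: a blinfun.add_right)
      moreover have "x + a \<in> A" using sub x a by (simp add: subspace_add)
      ultimately have "?q ((x + S t x) + v) = \<omega> (x + a) (nth_deriv 1 S t (x + a))"
        using vf by metis
      moreover have "?q v = \<omega> a (nth_deriv 1 S t a)" "?q (x + S t x) = \<omega> x (nth_deriv 1 S t x)"
        using vf a x by metis+
      moreover have "\<omega> x (nth_deriv 1 S t a) = 0"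
        using chart_maps_skew[OF tr(1) S1, of x a] x(2) by (simp add: omega_simps)
      ultimately show ?thesis using x(2) by (simp add: blinfun.add_right omega_simps)
    qed
    ultimately have "x + S t x = 0"
      unfolding nondegenerate_quadratic_on_def by blast
    then have "x = - S t x" by (simp add: eq_neg_iff_add_eq_0)
    then have "x \<in> D" using subspace_neg[OF sub(2) chart_maps_in[OF tr(1) S(1)[OF t]]] by metis
    then show "x = 0" using transverse_Int[OF tr(1) x(1)] by blast
  qed
  moreover have "(nth_deriv 1 S has_vector_derivative nth_deriv 2 S t) (at t)"
      "(nth_deriv 2 S has_vector_derivative nth_deriv 3 S t) (at t)" if "t \<in> J" for t
    using smooth_on_has_vector_derivative[OF smooth that, of 1]
      smooth_on_has_vector_derivative[OF smooth that, of 2] by (simp_all add: eval_nat_numeral)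
  ultimately have "jacobi_chart \<omega> A D J \<Gamma> S (nth_deriv 1 S) (nth_deriv 2 S) (nth_deriv 3 S)"
    using tr(1) J(1) S dS by unfold_locales
  then show ?thesis using that J by blast
qed

section \<open>Affine lines of Lagrangian subspaces\<close>

lemma chart_maps_scale: "transverse A D \<Longrightarrow> B \<in> chart_maps \<omega> A D \<Longrightarrow> h *\<^sub>R B \<in> chart_maps \<omega> A D"
  using subspace_scale[OF subspace_chart_maps] by (auto simp: transverse_def lagrangian_def)

text \<open>Since \<open>B\<close> squares to zero, the shears \<open>1 + h B\<close> form a
  one-parameter group; the origin can move along the line while the direction stays
  \<open>B\<close>.\<close>

lemma graph_over_line:
  assumes "transverse A D" "B \<in> chart_maps \<omega> A D"
  shows "B \<in> chart_maps \<omega> (graph_over A (h *\<^sub>R B)) D"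
    and "graph_over (graph_over A (h *\<^sub>R B)) (k *\<^sub>R B) = graph_over A ((h + k) *\<^sub>R B)"
proof -
  have sq: "B (B x) = 0" for x by (rule chart_maps_square[OF assms assms(2)])
  show "B \<in> chart_maps \<omega> (graph_over A (h *\<^sub>R B)) D"
    using chart_maps_zero[OF assms(2)] chart_maps_in[OF assms] chart_maps_skew[OF assms]
    by (simp add: chart_maps_def)
  show "graph_over (graph_over A (h *\<^sub>R B)) (k *\<^sub>R B) = graph_over A ((h + k) *\<^sub>R B)"
    by (simp add: graph_over_image image_image blinfun.bilinear_simps sq scaleR_add_left add.assoc)
qed

text \<open>Along an affinely parametrized line the second derivative vanishes at every point, so
  the uniqueness of the derivative element identifies it with \<open>\<Delta>\<close>.\<close>

lemma derivative_element_of_line: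
  assumes "jacobi_curve \<omega> I \<Gamma>" "s \<in> I" "transverse (\<Gamma> s) \<Delta>" "B \<in> chart_maps \<omega> (\<Gamma> s) \<Delta>"
    and "open U" "s \<in> U" "\<And>r. r \<in> U \<Longrightarrow> graph_over (\<Gamma> s) ((r - s) *\<^sub>R B) = \<Gamma> r"
  shows "derivative_element \<omega> \<Gamma> s = \<Delta>"
proof -
  obtain A D J S S1 S2 S3 where "s \<in> J" and jc: "jacobi_chart \<omega> A D J \<Gamma> S S1 S2 S3"
    using jacobi_chart_exists[OF assms(1,2)] by metis
  have ch: "nth_deriv 0 (\<lambda>r. chart \<omega> (\<Gamma> s) \<Delta> (\<Gamma> r)) r = (r - s) *\<^sub>R B" if "r \<in> U" for r
    using chart_eqI[OF assms(3) chart_maps_scale[OF assms(3,4)] assms(7)[OF that]] by simp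
  have "nth_deriv (Suc 0) (\<lambda>r. chart \<omega> (\<Gamma> s) \<Delta> (\<Gamma> r)) r = B" if "r \<in> U" for r
    by (rule nth_deriv_Suc_eqI[OF assms(5) that ch]) (auto intro!: derivative_eq_intros)
  then have "nth_deriv (Suc (Suc 0)) (\<lambda>r. chart \<omega> (\<Gamma> s) \<Delta> (\<Gamma> r)) s = 0"
    by (intro nth_deriv_Suc_eqI[OF assms(5,6), where g = "\<lambda>_. B"]) auto
  moreover have "\<Delta> \<in> transversals \<omega> (\<Gamma> s)"
    using assms(3) by (auto simp: transverse_def transversals_def)
  ultimately show ?thesis
    using jacobi_chart.derivative_element_eqI[OF jc \<open>s \<in> J\<close>] by (simp add: eval_nat_numeral)
qed

end

section \<open>Gluing the local lines along the interval\<close>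

theorem proposition6:
  fixes \<omega> :: "'a::euclidean_space \<Rightarrow> 'a \<Rightarrow> real"
    and n :: nat and I :: "real set" and \<Gamma> :: "real \<Rightarrow> 'a set"
  assumes "symplectic_form \<omega>" and "DIM('a) = 2 * n"
    and "open I" and "is_interval I" and "I \<noteq> {}"
    and "jacobi_curve \<omega> I \<Gamma>"
    and "projective_parameter \<omega> I \<Gamma>"
    and "\<forall>t\<in>I. \<forall>u\<in>\<Gamma> t. curvature \<omega> \<Gamma> t u = 0"
  shows "\<exists>C. regular_cycle \<omega> C \<and> \<Gamma> ` I \<subseteq> C"
proof -
  interpret symplectic \<omega> by unfold_locales (rule assms(1))
  let ?\<Delta> = "derivative_element \<omega> \<Gamma>"
  define straight where "straight s e B \<longleftrightarrow> e > 0 \<and> transverse (\<Gamma> s) (?\<Delta> s) \<and>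
      B \<in> chart_maps \<omega> (\<Gamma> s) (?\<Delta> s) \<and> (\<forall>x\<in>\<Gamma> s. blinfun_apply B x = 0 \<longrightarrow> x = 0) \<and>
      (\<forall>t. \<bar>t - s\<bar> < e \<longrightarrow> t \<in> I) \<and> (\<forall>t. \<bar>t - s\<bar> < e \<longrightarrow> graph_over (\<Gamma> s) ((t - s) *\<^sub>R B) = \<Gamma> t)"
    for s e B
  have "\<exists>e B. straight s e B" if s: "s \<in> I" for s
  proof -
    obtain A D J S S1 S2 S3 where J: "s \<in> J" "J \<subseteq> I" and "jacobi_chart \<omega> A D J \<Gamma> S S1 S2 S3"
      using jacobi_chart_exists[OF assms(6) s] by metis
    then interpret jacobi_chart \<omega> A D J \<Gamma> S S1 S2 S3 by simp
    have "curvature \<omega> \<Gamma> t u = 0" if "t \<in> J" "u \<in> \<Gamma> t" for t u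
      using assms(8) J that by blast
    from straight_near[OF J(1) this] show ?thesis
      unfolding straight_def using J(2) by (metis subsetD)
  qed
  then obtain e B where "straight s (e s) (B s)" if "s \<in> I" for s
    by metis
  then have e: "\<And>s. s \<in> I \<Longrightarrow> e s > 0" and tr: "\<And>s. s \<in> I \<Longrightarrow> transverse (\<Gamma> s) (?\<Delta> s)"
    and B: "\<And>s. s \<in> I \<Longrightarrow> B s \<in> chart_maps \<omega> (\<Gamma> s) (?\<Delta> s)"
    and inj: "\<And>s x. s \<in> I \<Longrightarrow> x \<in> \<Gamma> s \<Longrightarrow> blinfun_apply (B s) x = 0 \<Longrightarrow> x = 0"
    and eI: "\<And>s t. s \<in> I \<Longrightarrow> \<bar>t - s\<bar> < e s \<Longrightarrow> t \<in> I"
    and line: "\<And>s t. s \<in> I \<Longrightarrow> \<bar>t - s\<bar> < e s \<Longrightarrow> graph_over (\<Gamma> s) ((t - s) *\<^sub>R B s) = \<Gamma> t"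
    unfolding straight_def by blast+
  \<comment> \<open>The third component is the point of the local line at parameter
    \<open>0\<close>, which need not belong to \<open>I\<close>. It places all local lines, with
    their parametrizations, on a common footing.\<close>
  define \<Phi> where "\<Phi> s = (?\<Delta> s, B s, (\<lambda>x. x - s *\<^sub>R B s x) ` \<Gamma> s)" for s
  have loc: "\<Phi> t = \<Phi> s" if t: "t \<in> I" and st: "\<bar>s - t\<bar> < e t" for s t
  proof -
    have s: "s \<in> I" by (rule eI[OF t st])
    have \<Gamma>s: "\<Gamma> s = graph_over (\<Gamma> t) ((s - t) *\<^sub>R B t)" using line[OF t st] by simp
    have trs: "transverse (\<Gamma> s) (?\<Delta> t)"
      unfolding \<Gamma>s by (rule transverse_graph[OF tr[OF t] chart_maps_scale[OF tr[OF t] B[OF t]]])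
    have Bt: "B t \<in> chart_maps \<omega> (\<Gamma> s) (?\<Delta> t)"
      unfolding \<Gamma>s by (rule graph_over_line(1)[OF tr[OF t] B[OF t]])
    have gr: "graph_over (\<Gamma> s) ((r - s) *\<^sub>R B t) = \<Gamma> r" if "\<bar>r - t\<bar> < e t" for r
      unfolding \<Gamma>s graph_over_line(2)[OF tr[OF t] B[OF t]] using line[OF t that] by simp
    have \<Delta>: "?\<Delta> s = ?\<Delta> t"
      by (rule derivative_element_of_line[OF assms(6) s trs Bt, of "ball t (e t)"])
        (use st gr in \<open>auto simp: dist_real_def abs_minus_commute\<close>)
    \<comment> \<open>The two lines have the same point at \<open>s\<close>; one further common
      parameter \<open>r\<close> determines the direction, since a chart map is determined by its
      graph.\<close>
    obtain m where m: "0 < m" "m < e s" "m < e t - \<bar>s - t\<bar>"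
      using field_lbound_gt_zero[of "e s" "e t - \<bar>s - t\<bar>"] e[OF s] st by auto
    define r where "r = s + m"
    have r: "r \<noteq> s" "\<bar>r - s\<bar> < e s" "\<bar>r - t\<bar> < e t"
      using m by (auto simp: r_def)
    have "(r - s) *\<^sub>R B s = (r - s) *\<^sub>R B t"
    proof (rule chart_map_unique[OF trs])
      show "(r - s) *\<^sub>R B s \<in> chart_maps \<omega> (\<Gamma> s) (?\<Delta> t)"
        using chart_maps_scale[OF tr[OF s] B[OF s]] by (simp add: \<Delta>)
      show "(r - s) *\<^sub>R B t \<in> chart_maps \<omega> (\<Gamma> s) (?\<Delta> t)"
        by (rule chart_maps_scale[OF trs Bt])
      show "graph_over (\<Gamma> s) ((r - s) *\<^sub>R B s) = graph_over (\<Gamma> s) ((r - s) *\<^sub>R B t)"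
        using line[OF s r(2)] gr[OF r(3)] by simp
    qed
    then have Bst: "B s = B t" using r(1) by simp
    have "B t (B t x) = 0" for x
      by (rule chart_maps_square[OF tr[OF t] B[OF t] B[OF t]])
    then have "(\<lambda>x. x - s *\<^sub>R B t x) ` \<Gamma> s = (\<lambda>x. x - t *\<^sub>R B t x) ` \<Gamma> t"
      unfolding \<Gamma>s graph_over_image image_image
      by (simp add: blinfun.bilinear_simps scaleR_diff_left)
    then show ?thesis by (simp add: \<Phi>_def \<Delta> Bst)
  qed
  obtain t0 where t0: "t0 \<in> I" using assms(5) by blast
  have const: "\<Phi> t = \<Phi> t0" if "t \<in> I" for t
  proof (rule connected_local_const[OF is_interval_connected[OF assms(4)] that t0])
    show "\<forall>a\<in>I. \<forall>\<^sub>F b in at a within I. \<Phi> a = \<Phi> b"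
      unfolding eventually_at dist_real_def using loc e by blast
  qed
  define L where "L = range (\<lambda>s. graph_over (\<Gamma> t0) (s *\<^sub>R B t0))"
  have sq: "B t0 (B t0 x) = 0" for x
    by (rule chart_maps_square[OF tr[OF t0] B[OF t0] B[OF t0]])
  have "\<Gamma> t \<in> L" if t: "t \<in> I" for t
  proof -
    have Bt: "B t = B t0" and im: "(\<lambda>x. x - t *\<^sub>R B t0 x) ` \<Gamma> t = (\<lambda>x. x - t0 *\<^sub>R B t0 x) ` \<Gamma> t0"
      using const[OF t] by (auto simp: \<Phi>_def)
    \<comment> \<open>Shearing back from parameter \<open>0\<close> to \<open>t\<close> recovers
      \<open>\<Gamma> t\<close>, and the point at \<open>0\<close> may be computed from
      \<open>t0\<close> instead.\<close>
    have "(\<lambda>x. x + t *\<^sub>R B t0 x) ` (\<lambda>x. x - t *\<^sub>R B t0 x) ` \<Gamma> t = \<Gamma> t"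
      unfolding image_image by (simp add: blinfun.bilinear_simps sq)
    then have "\<Gamma> t = graph_over (\<Gamma> t0) ((t - t0) *\<^sub>R B t0)"
      unfolding im image_image graph_over_image
      by (simp add: blinfun.bilinear_simps sq scaleR_diff_left algebra_simps)
    then show ?thesis by (auto simp: L_def)
  qed
  moreover have "regular_cycle \<omega> (L \<union> {?\<Delta> t0})"
    unfolding regular_cycle_def
  proof (intro exI conjI)
    show lag: "lagrangian \<omega> (?\<Delta> t0)" using tr[OF t0] by (simp add: transverse_def)
    have lag0: "lagrangian \<omega> (\<Gamma> t0)" using tr[OF t0] by (simp add: transverse_def)
    have "B t0 \<noteq> 0"
    proof
      assume "B t0 = 0"
      then have "\<Gamma> t0 \<subseteq> {0}" using inj[OF t0] by auto
      then have "x \<in> \<Gamma> t0" for x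
        by (intro lagrangian_memI[OF lag0]) (auto simp: omega_simps)
      \<comment> \<open>A zero subspace can be Lagrangian only in the zero space, which a basis
        vector excludes.\<close>
      then have "(SOME b. b \<in> Basis) = (0::'a)" using \<open>\<Gamma> t0 \<subseteq> {0}\<close> by blast
      then show False using SOME_Basis nonzero_Basis by metis
    qed
    then show "affine_line \<omega> (?\<Delta> t0) L"
      unfolding affine_line_def L_def using transversals_iff[OF lag] tr[OF t0] B[OF t0] by blast
    show "regular_line L"
      unfolding regular_line_def L_def
    proof (intro ballI impI)
      fix \<Lambda>1 \<Lambda>2 assume "\<Lambda>1 \<in> range (\<lambda>s. graph_over (\<Gamma> t0) (s *\<^sub>R B t0))"
        "\<Lambda>2 \<in> range (\<lambda>s. graph_over (\<Gamma> t0) (s *\<^sub>R B t0))" and ne: "\<Lambda>1 \<noteq> \<Lambda>2"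
      then obtain s s' where \<Lambda>: "\<Lambda>1 = graph_over (\<Gamma> t0) (s *\<^sub>R B t0)"
          "\<Lambda>2 = graph_over (\<Gamma> t0) (s' *\<^sub>R B t0)" by blast
      then have "s \<noteq> s'" using ne by blast
      have "x = 0" if x: "x \<in> \<Lambda>1" "x \<in> \<Lambda>2" for x
      proof -
        obtain u u' where u: "u \<in> \<Gamma> t0" "x = u + s *\<^sub>R B t0 u" "u' \<in> \<Gamma> t0" "x = u' + s' *\<^sub>R B t0 u'"
          using x unfolding \<Lambda> graph_over_def by (auto simp: blinfun.scaleR_left)
        \<comment> \<open>Applying \<open>B t0\<close> removes the term with the parameter, so the
          two base vectors agree by injectivity; the remaining difference is
          \<open>(s - s') B u\<close>.\<close>
        have "B t0 x = B t0 u"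
          by (subst u(2)) (simp add: blinfun.add_right blinfun.scaleR_right sq)
        moreover have "B t0 x = B t0 u'"
          by (subst u(4)) (simp add: blinfun.add_right blinfun.scaleR_right sq)
        ultimately have eq: "B t0 u = B t0 u'" by simp
        have "u - u' \<in> \<Gamma> t0"
          using u lag0 by (intro subspace_diff lagrangian_subspace)
        then have "u = u'" using inj[OF t0, of "u - u'"] eq by (simp add: blinfun.diff_right)
        then have "(s - s') *\<^sub>R B t0 u = 0" using u(2,4) by (auto simp: scaleR_diff_left)
        then have "u = 0" using \<open>s \<noteq> s'\<close> inj[OF t0 u(1)] by simp
        then show ?thesis using u(2) by (simp add: blinfun.zero_right)
      qed
      moreover have "0 \<in> \<Lambda>1" "0 \<in> \<Lambda>2"
        unfolding \<Lambda> graph_over_def using subspace_0[OF lagrangian_subspace[OF lag0]]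
        by (auto intro!: exI[of _ 0] simp: blinfun.zero_right)
      ultimately show "\<Lambda>1 \<inter> \<Lambda>2 = {0}" by blast
    qed
  qed simp
  ultimately show ?thesis by blast
qed

end
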